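(* Let $T$ be an NSOP$_1$ theory and let $\perp^K$ be Kim-independence in $T$. Then $\perp^f=(\perp^K)^{M*}=(\perp^K)^{m*}$.
   Context: Work in a monster model of the complete theory $T$; $A,B,C,D$ denote small subsets (or tuples), $AB$ means $A\cup B$. For a ternary relation $\perp$ on small subsets define: - $A\perp^M_C B$ iff $A\perp_D B$ for all $D$ with $C\subseteq D\subseteq\mathrm{acl}(BC)$; - $A\perp^m_C B$ iff $A\perp_D B$ for all $D$ with $C\subseteq D\subseteq BC$; - $A\perp^*_C B$ iff for every small $D\supseteq B$ there is $A'\equiv_{BC}A$ with $A'\perp_C D$. Write $\perp^{M*}:=(\perp^M)^*$ and $\perp^{m*}:=(\perp^m)^*$. $A\perp^f_C B$ means that $\mathrm{tp}(A/BC)$ does not fork over $C$. Kim-independence: a formula $\varphi(x,b)$ Kim-divides over $C$ if there is a Morley sequence $(b_i)_{i<\omega}$ over $C$ in $\mathrm{tp}(b/C)$ (i.e. a $C$-indiscernible sequence with $b_i\equiv_C b$ and $b_i\perp^f_C b_{<i}$ for all $i$) such that $\{\varphi(x,b_i):i<\omega\}$ is inconsistent; $A\perp^K_C B$ means that no formula in $\mathrm{tp}(A/BC)$ Kim-divides over $C$. Over models this is the usual Kim-independence of NSOP$_1$ theories. *)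

theory Defs
  imports Main
begin

unbundle cardinal_syntax

section \<open>First-order logic\<close>

text \<open>
  A symbol belongs to the language iff its arity is not \<open>None\<close>; thus a language may lack
  function symbols (or relation symbols) although HOL types are nonempty.
\<close>

record ('f, 'r) lang =
  fun_ar :: "'f \<Rightarrow> nat option"
  rel_ar :: "'r \<Rightarrow> nat option"

datatype 'f tm = Var nat | Fun 'f "'f tm list"

datatype ('f, 'r) fm =
    Eq "'f tm" "'f tm"
  | Rel 'r "'f tm list"
  | Neg "('f, 'r) fm"
  | Conj "('f, 'r) fm" "('f, 'r) fm"
  | Ex nat "('f, 'r) fm"

primrec fv_tm :: "'f tm \<Rightarrow> nat set" where
  "fv_tm (Var i) = {i}"
| "fv_tm (Fun f ts) = \<Union> (set (map fv_tm ts))"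

primrec fv :: "('f, 'r) fm \<Rightarrow> nat set" where
  "fv (Eq t u) = fv_tm t \<union> fv_tm u"
| "fv (Rel r ts) = \<Union> (fv_tm ` set ts)"
| "fv (Neg \<phi>) = fv \<phi>"
| "fv (Conj \<phi> \<psi>) = fv \<phi> \<union> fv \<psi>"
| "fv (Ex i \<phi>) = fv \<phi> - {i}"

primrec wf_tm :: "('f, 'r, 'z) lang_scheme \<Rightarrow> 'f tm \<Rightarrow> bool" where
  "wf_tm L (Var i) \<longleftrightarrow> True"
| "wf_tm L (Fun f ts) \<longleftrightarrow> fun_ar L f = Some (length ts) \<and> list_all id (map (wf_tm L) ts)"

primrec wf_fm :: "('f, 'r, 'z) lang_scheme \<Rightarrow> ('f, 'r) fm \<Rightarrow> bool" where
  "wf_fm L (Eq t u) \<longleftrightarrow> wf_tm L t \<and> wf_tm L u"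
| "wf_fm L (Rel r ts) \<longleftrightarrow> rel_ar L r = Some (length ts) \<and> list_all (wf_tm L) ts"
| "wf_fm L (Neg \<phi>) \<longleftrightarrow> wf_fm L \<phi>"
| "wf_fm L (Conj \<phi> \<psi>) \<longleftrightarrow> wf_fm L \<phi> \<and> wf_fm L \<psi>"
| "wf_fm L (Ex i \<phi>) \<longleftrightarrow> wf_fm L \<phi>"

text \<open>
  A structure carries its language; its universe is the whole type \<open>'a\<close>. Interpretations of
  symbols on lists of the wrong length are junk and never used.
\<close>

record ('f, 'r, 'a) model = "('f, 'r) lang" +
  fun_int :: "'f \<Rightarrow> 'a list \<Rightarrow> 'a"
  rel_int :: "'r \<Rightarrow> 'a list \<Rightarrow> bool"

primrec eval :: "('f, 'r, 'a) model \<Rightarrow> (nat \<Rightarrow> 'a) \<Rightarrow> 'f tm \<Rightarrow> 'a" where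
  "eval M e (Var i) = e i"
| "eval M e (Fun f ts) = fun_int M f (map (eval M e) ts)"

primrec sat :: "('f, 'r, 'a) model \<Rightarrow> (nat \<Rightarrow> 'a) \<Rightarrow> ('f, 'r) fm \<Rightarrow> bool" where
  "sat M e (Eq t u) \<longleftrightarrow> eval M e t = eval M e u"
| "sat M e (Rel r ts) \<longleftrightarrow> rel_int M r (map (eval M e) ts)"
| "sat M e (Neg \<phi>) \<longleftrightarrow> \<not> sat M e \<phi>"
| "sat M e (Conj \<phi> \<psi>) \<longleftrightarrow> sat M e \<phi> \<and> sat M e \<psi>"
| "sat M e (Ex i \<phi>) \<longleftrightarrow> (\<exists>x. sat M (e(i := x)) \<phi>)"

text \<open>The formulas in the free variables \<open>0, \<dots>, n - 1\<close>.\<close>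

definition formulas :: "('f, 'r, 'z) lang_scheme \<Rightarrow> nat \<Rightarrow> ('f, 'r) fm set" where
  "formulas L n = {\<phi>. wf_fm L \<phi> \<and> fv \<phi> \<subseteq> {..<n}}"

definition holds :: "('f, 'r, 'a) model \<Rightarrow> ('f, 'r) fm \<Rightarrow> 'a list \<Rightarrow> bool" where
  "holds M \<phi> a \<longleftrightarrow> sat M (\<lambda>i. if i < length a then a ! i else undefined) \<phi>"

text \<open>
  Complete theories are taken to be deductively closed, that is, maximal; consistency is
  implied whenever the theory has a model.
\<close>

definition complete_theory :: "('f, 'r, 'z) lang_scheme \<Rightarrow> ('f, 'r) fm set \<Rightarrow> bool" where
  "complete_theory L T \<longleftrightarrow> T \<subseteq> formulas L 0 \<and> (\<forall>\<phi> \<in> formulas L 0. \<phi> \<in> T \<or> Neg \<phi> \<in> T)"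

definition models :: "('f, 'r, 'a) model \<Rightarrow> ('f, 'r) fm set \<Rightarrow> bool" where
  "models M T \<longleftrightarrow> (\<forall>\<phi> \<in> T. holds M \<phi> [])"

section \<open>Types\<close>

text \<open>
  A pair \<open>(\<phi>, b)\<close> stands for the formula \<open>\<phi>(x, b)\<close> with parameters; if \<open>x\<close> has length \<open>n\<close>, then
  \<open>x\<close> occupies the variables \<open>0, \<dots>, n - 1\<close> of \<open>\<phi>\<close> and \<open>b\<close> is substituted for the variables
  \<open>n, \<dots>, n + length b - 1\<close>.
\<close>

type_synonym ('f, 'r, 'a) pfm = "('f, 'r) fm \<times> 'a list"

definition pformulas :: "('f, 'r, 'a) model \<Rightarrow> nat \<Rightarrow> 'a set \<Rightarrow> ('f, 'r, 'a) pfm set" where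
  "pformulas M n B = {(\<phi>, b). set b \<subseteq> B \<and> \<phi> \<in> formulas M (n + length b)}"

definition psat :: "('f, 'r, 'a) model \<Rightarrow> 'a list \<Rightarrow> ('f, 'r, 'a) pfm \<Rightarrow> bool" where
  "psat M a \<sigma> \<longleftrightarrow> holds M (fst \<sigma>) (a @ snd \<sigma>)"

definition tp :: "('f, 'r, 'a) model \<Rightarrow> 'a list \<Rightarrow> 'a set \<Rightarrow> ('f, 'r, 'a) pfm set" where
  "tp M a B = {\<sigma> \<in> pformulas M (length a) B. psat M a \<sigma>}"

text \<open>Equality of types over \<open>C\<close>, for finite tuples and for sets (enumerated by themselves).\<close>

definition tuple_equiv :: "('f, 'r, 'a) model \<Rightarrow> 'a set \<Rightarrow> 'a list \<Rightarrow> 'a list \<Rightarrow> bool" where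
  "tuple_equiv M C a a' \<longleftrightarrow> length a = length a' \<and> tp M a C = tp M a' C"

definition elementary_on :: "('f, 'r, 'a) model \<Rightarrow> 'a set \<Rightarrow> 'a set \<Rightarrow> ('a \<Rightarrow> 'a) \<Rightarrow> bool" where
  "elementary_on M C A g \<longleftrightarrow> (\<forall>a. set a \<subseteq> A \<longrightarrow> tuple_equiv M C a (map g a))"

definition set_equiv :: "('f, 'r, 'a) model \<Rightarrow> 'a set \<Rightarrow> 'a set \<Rightarrow> 'a set \<Rightarrow> bool" where
  "set_equiv M C A A' \<longleftrightarrow> (\<exists>g. g ` A = A' \<and> elementary_on M C A g)"

text \<open>Consistency (with the elementary diagram of \<open>M\<close>) of a set of formulas in \<open>n\<close> variables.\<close>

definition consistent :: "('f, 'r, 'a) model \<Rightarrow> nat \<Rightarrow> ('f, 'r, 'a) pfm set \<Rightarrow> bool" where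
  "consistent M n \<Sigma> \<longleftrightarrow>
     (\<forall>\<Sigma>\<^sub>0. finite \<Sigma>\<^sub>0 \<and> \<Sigma>\<^sub>0 \<subseteq> \<Sigma> \<longrightarrow> (\<exists>a. length a = n \<and> (\<forall>\<sigma> \<in> \<Sigma>\<^sub>0. psat M a \<sigma>)))"

definition acl :: "('f, 'r, 'a) model \<Rightarrow> 'a set \<Rightarrow> 'a set" where
  "acl M B = {a. \<exists>\<sigma> \<in> pformulas M 1 B. psat M [a] \<sigma> \<and> finite {a'. psat M [a'] \<sigma>}}"

section \<open>Monster models\<close>

definition small :: "'k rel \<Rightarrow> 'a set \<Rightarrow> bool" where
  "small \<kappa> A \<longleftrightarrow> |A| <o \<kappa>"

definition saturated :: "'k rel \<Rightarrow> ('f, 'r, 'a) model \<Rightarrow> bool" where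
  "saturated \<kappa> M \<longleftrightarrow>
     (\<forall>B \<Sigma>. small \<kappa> B \<and> \<Sigma> \<subseteq> pformulas M 1 B \<and> consistent M 1 \<Sigma> \<longrightarrow> (\<exists>a. \<forall>\<sigma> \<in> \<Sigma>. psat M [a] \<sigma>))"

definition automorphism :: "('f, 'r, 'a) model \<Rightarrow> ('a \<Rightarrow> 'a) \<Rightarrow> bool" where
  "automorphism M g \<longleftrightarrow> bij g \<and>
     (\<forall>f a. fun_ar M f = Some (length a) \<longrightarrow> fun_int M f (map g a) = g (fun_int M f a)) \<and>
     (\<forall>r a. rel_ar M r = Some (length a) \<longrightarrow> rel_int M r (map g a) = rel_int M r a)"

definition strongly_homogeneous :: "'k rel \<Rightarrow> ('f, 'r, 'a) model \<Rightarrow> bool" where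
  "strongly_homogeneous \<kappa> M \<longleftrightarrow>
     (\<forall>A g. small \<kappa> A \<and> elementary_on M {} A g \<longrightarrow> (\<exists>h. automorphism M h \<and> (\<forall>a \<in> A. h a = g a)))"

text \<open>
  The set of all formulas has the cardinality of the language plus \<open>\<aleph>\<^sub>0\<close>, so the second
  condition says \<open>\<kappa> > |T|\<close>, in the usual sense of \<open>|T|\<close>.
\<close>

definition monster_model :: "'k rel \<Rightarrow> ('f, 'r, 'a) model \<Rightarrow> ('f, 'r) fm set \<Rightarrow> bool" where
  "monster_model \<kappa> M T \<longleftrightarrow>
     Card_order \<kappa> \<and> |{\<phi> :: ('f, 'r) fm. wf_fm M \<phi>}| <o \<kappa> \<and>
     models M T \<and> saturated \<kappa> M \<and> strongly_homogeneous \<kappa> M"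

text \<open>
  The theory of \<open>M\<close> is NSOP1. The nodes of the tree \<open>2\<^bsup><\<omega>\<^esup>\<close> are lists of Booleans, and its
  branches are functions \<open>\<eta> :: nat \<Rightarrow> bool\<close>.
\<close>

definition has_SOP1 :: "('f, 'r, 'a) model \<Rightarrow> nat \<Rightarrow> nat \<Rightarrow> ('f, 'r) fm \<Rightarrow> bool" where
  "has_SOP1 M n m \<phi> \<longleftrightarrow>
     (\<exists>b :: bool list \<Rightarrow> 'a list.
        (\<forall>s. length (b s) = m) \<and>
        (\<forall>\<eta> :: nat \<Rightarrow> bool. consistent M n (range (\<lambda>k. (\<phi>, b (map \<eta> [0..<k]))))) \<and>
        (\<forall>s t. \<not> consistent M n {(\<phi>, b (s @ [False] @ t)), (\<phi>, b (s @ [True]))}))"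

definition NSOP1 :: "('f, 'r, 'a) model \<Rightarrow> bool" where
  "NSOP1 M \<longleftrightarrow> (\<forall>n m. \<forall>\<phi> \<in> formulas M (n + m). \<not> has_SOP1 M n m \<phi>)"

section \<open>Forking and Kim-independence\<close>

definition indiscernible :: "('f, 'r, 'a) model \<Rightarrow> 'a set \<Rightarrow> (nat \<Rightarrow> 'a list) \<Rightarrow> bool" where
  "indiscernible M C s \<longleftrightarrow>
     (\<forall>is js. sorted_wrt (<) is \<and> sorted_wrt (<) js \<and> length is = length js \<longrightarrow>
        tuple_equiv M C (concat (map s is)) (concat (map s js)))"

text \<open>In the following definitions, \<open>n\<close> is the length of the tuple \<open>x\<close> in \<open>\<phi>(x, b)\<close>.\<close>

definition divides :: "('f, 'r, 'a) model \<Rightarrow> nat \<Rightarrow> 'a set \<Rightarrow> ('f, 'r, 'a) pfm \<Rightarrow> bool" where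
  "divides M n C = (\<lambda>(\<phi>, b).
     \<exists>s. indiscernible M C s \<and> (\<forall>i. tuple_equiv M C (s i) b) \<and>
       \<not> consistent M n (range (\<lambda>i. (\<phi>, s i))))"

definition forks :: "('f, 'r, 'a) model \<Rightarrow> nat \<Rightarrow> 'a set \<Rightarrow> ('f, 'r, 'a) pfm \<Rightarrow> bool" where
  "forks M n C \<sigma> \<longleftrightarrow>
     (\<exists>\<Psi>. finite \<Psi> \<and> \<Psi> \<subseteq> pformulas M n UNIV \<and> (\<forall>\<psi> \<in> \<Psi>. divides M n C \<psi>) \<and>
       (\<forall>a. length a = n \<and> psat M a \<sigma> \<longrightarrow> (\<exists>\<psi> \<in> \<Psi>. psat M a \<psi>)))"

text \<open>
  All ternary relations take their arguments in the order \<open>A\<close>, \<open>C\<close>, \<open>B\<close>. A formula of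
  \<open>tp(A/BC)\<close> involves only finitely many of the variables indexed by \<open>A\<close>, so it is a formula
  of \<open>tp(a/BC)\<close> for a finite tuple \<open>a\<close> from \<open>A\<close>.
\<close>

definition indep_f :: "('f, 'r, 'a) model \<Rightarrow> 'a set \<Rightarrow> 'a set \<Rightarrow> 'a set \<Rightarrow> bool" where
  "indep_f M A C B \<longleftrightarrow>
     (\<forall>a. set a \<subseteq> A \<longrightarrow> (\<forall>\<sigma> \<in> tp M a (B \<union> C). \<not> forks M (length a) C \<sigma>))"

definition morley_sequence ::
    "('f, 'r, 'a) model \<Rightarrow> 'a set \<Rightarrow> 'a list \<Rightarrow> (nat \<Rightarrow> 'a list) \<Rightarrow> bool" where
  "morley_sequence M C b s \<longleftrightarrow>
     indiscernible M C s \<and> (\<forall>i. tuple_equiv M C (s i) b) \<and>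
     (\<forall>i. indep_f M (set (s i)) C (\<Union>j<i. set (s j)))"

definition kim_divides :: "('f, 'r, 'a) model \<Rightarrow> nat \<Rightarrow> 'a set \<Rightarrow> ('f, 'r, 'a) pfm \<Rightarrow> bool" where
  "kim_divides M n C = (\<lambda>(\<phi>, b).
     \<exists>s. morley_sequence M C b s \<and> \<not> consistent M n (range (\<lambda>i. (\<phi>, s i))))"

definition indep_K :: "('f, 'r, 'a) model \<Rightarrow> 'a set \<Rightarrow> 'a set \<Rightarrow> 'a set \<Rightarrow> bool" where
  "indep_K M A C B \<longleftrightarrow>
     (\<forall>a. set a \<subseteq> A \<longrightarrow> (\<forall>\<sigma> \<in> tp M a (B \<union> C). \<not> kim_divides M (length a) C \<sigma>))"

section \<open>Operations on ternary relations\<close>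

type_synonym 'a ternary = "'a set \<Rightarrow> 'a set \<Rightarrow> 'a set \<Rightarrow> bool"

definition upM :: "('f, 'r, 'a) model \<Rightarrow> 'a ternary \<Rightarrow> 'a ternary" where
  "upM M R A C B \<longleftrightarrow> (\<forall>D. C \<subseteq> D \<and> D \<subseteq> acl M (B \<union> C) \<longrightarrow> R A D B)"

definition upm :: "'a ternary \<Rightarrow> 'a ternary" where
  "upm R A C B \<longleftrightarrow> (\<forall>D. C \<subseteq> D \<and> D \<subseteq> B \<union> C \<longrightarrow> R A D B)"

definition star :: "'k rel \<Rightarrow> ('f, 'r, 'a) model \<Rightarrow> 'a ternary \<Rightarrow> 'a ternary" where
  "star \<kappa> M R A C B \<longleftrightarrow>
     (\<forall>D. small \<kappa> D \<and> B \<subseteq> D \<longrightarrow> (\<exists>A'. set_equiv M (B \<union> C) A A' \<and> R A' C D))"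

end

theory Submission
  imports Defs "HOL-Library.Countable_Set"
begin

text \<open>
  Forking independence has extension, and it implies \<open>\<bottom>\<^sup>K\<close> over every base between \<open>C\<close> and
  \<open>acl(BC)\<close> once the right-hand side contains \<open>acl(BC)\<close>, because Kim-dividing over a larger base
  implies dividing over \<open>C\<close>. Conversely, a formula \<open>\<psi>(x, b)\<close> that divides over \<open>C\<close> Kim-divides
  over \<open>C \<union> I\<close>, where \<open>I\<close> consists of the terms of a suitable indiscernible sequence. If a formula
  implies a finite disjunction of such \<open>\<psi>(x, b)\<close>, adding all these \<open>b\<close> and \<open>I\<close> to the right-hand
  side shows that it cannot belong to a type that is \<open>(\<bottom>\<^sup>K)\<^sup>m\<^sup>*\<close>-independent.
\<close>

section \<open>Definable predicates\<close>

text \<open>The sequence that witnesses dividing over \<open>C\<close> is merely indiscernible: a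
  term may fork over \<open>C\<close> with its predecessors, so the sequence need not be a Morley
  sequence over \<open>C\<close>. Enlarging the base repairs this. A type that is finitely
  satisfiable in the base does not fork over it, because a realization inside the base survives
  every change of parameters along a sequence indiscernible over the base. So the base has to
  contain tuples filling the same cuts as the terms of the intended Morley sequence, and the upper
  half of a stretched sequence supplies them. The operation \<open>upm\<close> admits the enlarged
  base only if it lies within the right-hand side together with \<open>C\<close>, and
  \<open>star\<close> makes room for it there.

  \<open>upM\<close> ranges over more bases than \<open>upm\<close>, so the three relations are
  compared in one cycle of implications. Smallness is derived without regularity of
  \<open>\<kappa>\<close>: from finite unions, from countability, and for \<open>acl\<close> from a
  bound by \<open>B\<close> plus the set of formulas.\<close>

lemma eval_cong:
  assumes "\<And>i. i \<in> fv_tm t \<Longrightarrow> e i = e' i"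
  shows "eval M e t = eval M e' t"
  using assms
proof (induction t)
  case (Fun f ts)
  have "eval M e t = eval M e' t" if "t \<in> set ts" for t
    using Fun that by auto
  then show ?case by (simp cong: map_cong)
qed simp

lemma sat_cong:
  assumes "\<And>i. i \<in> fv \<phi> \<Longrightarrow> e i = e' i"
  shows "sat M e \<phi> \<longleftrightarrow> sat M e' \<phi>"
  using assms
proof (induction \<phi> arbitrary: e e')
  case (Eq t u)
  then show ?case using eval_cong[of t e e' M] eval_cong[of u e e' M] by auto
next
  case (Rel r ts)
  then have "map (eval M e) ts = map (eval M e') ts"
    by (auto intro!: eval_cong)
  then show ?case by (simp del: map_eq_conv)
next
  case (Neg \<phi>)
  then show ?case by (metis fv.simps(3) sat.simps(3))
next
  case (Conj \<phi> \<psi>)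
  then show ?case by (metis UnCI fv.simps(4) sat.simps(4))
next
  case (Ex i \<phi>)
  have "sat M (e(i := x)) \<phi> \<longleftrightarrow> sat M (e'(i := x)) \<phi>" for x
    by (rule Ex.IH) (use Ex.prems in auto)
  then show ?case by simp
qed

lemma finite_fv_tm: "finite (fv_tm t)"
  by (induction t) auto

lemma finite_fv: "finite (fv \<phi>)"
  by (induction \<phi>) (auto simp: finite_fv_tm)

section \<open>Renaming of free variables\<close>

primrec rename_tm :: "(nat \<Rightarrow> nat) \<Rightarrow> 'f tm \<Rightarrow> 'f tm" where
  "rename_tm f (Var i) = Var (f i)"
| "rename_tm f (Fun g ts) = Fun g (map (rename_tm f) ts)"

lemma wf_rename_tm: "wf_tm L t \<Longrightarrow> wf_tm L (rename_tm f t)"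
  by (induction t) (auto simp: list_all_iff)

lemma fv_rename_tm: "fv_tm (rename_tm f t) = f ` fv_tm t"
  by (induction t) auto

lemma eval_rename_tm: "eval M e (rename_tm f t) = eval M (e \<circ> f) t"
  by (induction t) (auto intro!: arg_cong[where f = "fun_int M _"])

text \<open>Bound variables have to be chosen afresh to avoid capture, so the renamed formula is
  only shown to exist. The map \<open>f\<close> may identify variables; this is used when several
  variables stand for the same argument.\<close>

lemma rename_fm:
  "\<exists>\<psi>. (wf_fm M \<phi> \<longrightarrow> wf_fm M \<psi>) \<and> fv \<psi> = f ` fv \<phi> \<and> (\<forall>e. sat M e \<psi> \<longleftrightarrow> sat M (e \<circ> f) \<phi>)"
proof (induction \<phi> arbitrary: f)
  case (Eq t u)
  show ?case
    by (rule exI[of _ "Eq (rename_tm f t) (rename_tm f u)"])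
      (auto simp: wf_rename_tm fv_rename_tm eval_rename_tm comp_def image_Un)
next
  case (Rel r ts)
  show ?case
    by (rule exI[of _ "Rel r (map (rename_tm f) ts)"])
      (auto simp: wf_rename_tm fv_rename_tm eval_rename_tm list_all_iff comp_def)
next
  case (Neg \<phi>)
  from Neg[of f] obtain \<psi> where "(wf_fm M \<phi> \<longrightarrow> wf_fm M \<psi>) \<and> fv \<psi> = f ` fv \<phi> \<and>
    (\<forall>e. sat M e \<psi> \<longleftrightarrow> sat M (e \<circ> f) \<phi>)" by blast
  then show ?case by (intro exI[of _ "Neg \<psi>"]) (simp add: comp_def)
next
  case (Conj \<phi>1 \<phi>2)
  from Conj.IH(1)[of f] obtain \<psi>1 where "(wf_fm M \<phi>1 \<longrightarrow> wf_fm M \<psi>1) \<and> fv \<psi>1 = f ` fv \<phi>1 \<and>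
    (\<forall>e. sat M e \<psi>1 \<longleftrightarrow> sat M (e \<circ> f) \<phi>1)" by blast
  moreover from Conj.IH(2)[of f] obtain \<psi>2 where "(wf_fm M \<phi>2 \<longrightarrow> wf_fm M \<psi>2) \<and>
    fv \<psi>2 = f ` fv \<phi>2 \<and> (\<forall>e. sat M e \<psi>2 \<longleftrightarrow> sat M (e \<circ> f) \<phi>2)" by blast
  ultimately show ?case by (intro exI[of _ "Conj \<psi>1 \<psi>2"]) (auto simp: image_Un comp_def)
next
  case (Ex i \<phi>)
  \<comment> \<open>A bound variable outside the image of \<open>f\<close> captures none of the
    renamed free variables.\<close>
  obtain j where j: "j \<notin> f ` fv \<phi>"
    using ex_new_if_finite[of "f ` fv \<phi>"] finite_fv[of \<phi>] by auto
  from Ex[of "f(i := j)"] obtain \<psi> where \<psi>: "wf_fm M \<phi> \<longrightarrow> wf_fm M \<psi>"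
    "fv \<psi> = (f(i := j)) ` fv \<phi>" "\<forall>e. sat M e \<psi> \<longleftrightarrow> sat M (e \<circ> f(i := j)) \<phi>" by blast
  have "fv \<psi> - {j} = f ` (fv \<phi> - {i})"
    using j \<psi>(2) by (auto simp: image_iff)
  moreover have "sat M (e(j := x)) \<psi> \<longleftrightarrow> sat M ((e \<circ> f)(i := x)) \<phi>" for e x
    unfolding \<psi>(3)[rule_format] by (rule sat_cong) (use j in auto)
  ultimately show ?case
    using \<psi>(1) by (intro exI[of _ "Ex j \<psi>"]) (auto simp: comp_def)
qed

text \<open>
  The variables of the formula are sorted by \<open>\<rho>\<close> into arguments of the predicate, indexed by
  \<open>W\<close>, and parameters from \<open>B\<close>. The argument type is arbitrary, so that the index sets can be
  chosen to fit each application and no bookkeeping of variable numbers is needed.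
\<close>

definition definable ::
    "('f, 'r, 'a) model \<Rightarrow> 'a set \<Rightarrow> 'v set \<Rightarrow> (('v \<Rightarrow> 'a) \<Rightarrow> bool) \<Rightarrow> bool" where
  "definable M B W P \<longleftrightarrow>
     (\<exists>\<phi> \<rho>. wf_fm M \<phi> \<and> \<rho> ` fv \<phi> \<subseteq> W <+> B \<and> (\<forall>v. P v \<longleftrightarrow> sat M (case_sum v id \<circ> \<rho>) \<phi>))"

lemma definableI:
  assumes "wf_fm M \<phi>" "\<rho> ` fv \<phi> \<subseteq> W <+> B" "\<And>v. P v \<longleftrightarrow> sat M (case_sum v id \<circ> \<rho>) \<phi>"
  shows "definable M B W P"
  using assms unfolding definable_def by blast

lemma definable_cong:
  assumes "definable M B W P" "\<And>x. x \<in> W \<Longrightarrow> u x = v x"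
  shows "P u \<longleftrightarrow> P v"
proof -
  obtain \<phi> \<rho> where \<rho>: "\<rho> ` fv \<phi> \<subseteq> W <+> B" "\<forall>v. P v \<longleftrightarrow> sat M (case_sum v id \<circ> \<rho>) \<phi>"
    using assms(1) unfolding definable_def by blast
  have "sat M (case_sum u id \<circ> \<rho>) \<phi> \<longleftrightarrow> sat M (case_sum v id \<circ> \<rho>) \<phi>"
  proof (rule sat_cong)
    fix i assume "i \<in> fv \<phi>"
    then have "\<rho> i \<in> W <+> B" using \<rho>(1) by blast
    then show "(case_sum u id \<circ> \<rho>) i = (case_sum v id \<circ> \<rho>) i"
      using assms(2) by auto
  qed
  then show ?thesis using \<rho>(2) by blast
qed

lemma definable_True: "definable M B W (\<lambda>v. True)"
  \<comment> \<open>A closed tautology, since \<open>W\<close> and \<open>B\<close> may be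
    empty.\<close>
  by (rule definableI[of _ "Ex 0 (Eq (Var 0) (Var 0))"]) auto

lemma definable_eq: "x \<in> W \<Longrightarrow> c \<in> B \<Longrightarrow> definable M B W (\<lambda>v. v x = c)"
  by (rule definableI[of _ "Eq (Var 0) (Var 1)" "case_nat (Inl x) (\<lambda>_. Inr c)"]) auto

text \<open>The two formulas come with unrelated sortings \<open>\<rho>\<close> and
  \<open>\<tau>\<close>. Moving one to the even and the other to the odd variables lets the sortings
  be merged.\<close>

lemma definable_conj:
  assumes "definable M B W P" "definable M B W Q"
  shows "definable M B W (\<lambda>v. P v \<and> Q v)"
proof -
  obtain \<phi> \<rho> where \<phi>: "wf_fm M \<phi>" "\<rho> ` fv \<phi> \<subseteq> W <+> B"
    "\<forall>v. P v \<longleftrightarrow> sat M (case_sum v id \<circ> \<rho>) \<phi>"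
    using assms(1) unfolding definable_def by blast
  obtain \<psi> \<tau> where \<psi>: "wf_fm M \<psi>" "\<tau> ` fv \<psi> \<subseteq> W <+> B"
    "\<forall>v. Q v \<longleftrightarrow> sat M (case_sum v id \<circ> \<tau>) \<psi>"
    using assms(2) unfolding definable_def by blast
  obtain \<phi>' where \<phi>': "wf_fm M \<phi>'" "fv \<phi>' = (\<lambda>i. 2 * i) ` fv \<phi>"
    "\<forall>e. sat M e \<phi>' \<longleftrightarrow> sat M (e \<circ> (\<lambda>i. 2 * i)) \<phi>"
    using rename_fm[of M \<phi> "\<lambda>i. 2 * i"] \<phi>(1) by blast
  obtain \<psi>' where \<psi>': "wf_fm M \<psi>'" "fv \<psi>' = (\<lambda>i. 2 * i + 1) ` fv \<psi>"
    "\<forall>e. sat M e \<psi>' \<longleftrightarrow> sat M (e \<circ> (\<lambda>i. 2 * i + 1)) \<psi>"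
    using rename_fm[of M \<psi> "\<lambda>i. 2 * i + 1"] \<psi>(1) by blast
  let ?\<rho> = "\<lambda>i. if even i then \<rho> (i div 2) else \<tau> (i div 2)"
  show ?thesis
  proof (rule definableI[of _ "Conj \<phi>' \<psi>'" ?\<rho>])
    show "?\<rho> ` fv (Conj \<phi>' \<psi>') \<subseteq> W <+> B"
      using \<phi>(2) \<psi>(2) by (auto simp: \<phi>'(2) \<psi>'(2) image_subset_iff)
    show "P v \<and> Q v \<longleftrightarrow> sat M (case_sum v id \<circ> ?\<rho>) (Conj \<phi>' \<psi>')" for v
      by (simp add: \<phi>(3) \<psi>(3) \<phi>'(3) \<psi>'(3) comp_def)
  qed (simp add: \<phi>'(1) \<psi>'(1))
qed

lemma definable_ball:
  assumes "finite I" "\<And>i. i \<in> I \<Longrightarrow> definable M B W (P i)"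
  shows "definable M B W (\<lambda>v. \<forall>i\<in>I. P i v)"
  using assms
proof (induction I rule: finite_induct)
  case empty
  then show ?case by (simp add: definable_True)
next
  case (insert i I)
  then show ?case using definable_conj[of M B W "P i" "\<lambda>v. \<forall>i\<in>I. P i v"] by simp
qed

lemma definable_ex1:
  assumes "definable M B W P"
  shows "definable M B (W - {x}) (\<lambda>v. \<exists>a. P (v(x := a)))"
proof -
  obtain \<phi> \<rho> where \<phi>: "wf_fm M \<phi>" "\<rho> ` fv \<phi> \<subseteq> W <+> B"
    "\<forall>v. P v \<longleftrightarrow> sat M (case_sum v id \<circ> \<rho>) \<phi>"
    using assms(1) unfolding definable_def by blast
  \<comment> \<open>Several variables may be sorted to \<open>x\<close>; all of them become the
    variable 0, which is then quantified, and the others are shifted out of its way.\<close>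
  define f where "f = (\<lambda>i. if \<rho> i = Inl x then 0 else Suc i)"
  obtain \<psi> where \<psi>: "wf_fm M \<psi>" "fv \<psi> = f ` fv \<phi>"
    "\<forall>e. sat M e \<psi> \<longleftrightarrow> sat M (e \<circ> f) \<phi>"
    using rename_fm[of M \<phi> f] \<phi>(1) by blast
  let ?\<rho> = "case_nat (Inl x) \<rho>"
  show ?thesis
  proof (rule definableI[of _ "Ex 0 \<psi>" ?\<rho>])
    show "?\<rho> ` fv (Ex 0 \<psi>) \<subseteq> (W - {x}) <+> B"
      using \<phi>(2) by (auto simp: \<psi>(2) f_def)
    have "(case_sum v id \<circ> ?\<rho>)(0 := a) \<circ> f = case_sum (v(x := a)) id \<circ> \<rho>" for v a
      by (rule ext) (auto simp: f_def split: sum.split)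
    then show "(\<exists>a. P (v(x := a))) \<longleftrightarrow> sat M (case_sum v id \<circ> ?\<rho>) (Ex 0 \<psi>)" for v
      using \<phi>(3) \<psi>(3) by simp
  qed (simp add: \<psi>(1))
qed

lemma definable_ex:
  assumes "finite Z" "definable M B W P"
  shows "definable M B (W - Z) (\<lambda>v. \<exists>u. (\<forall>x. x \<notin> Z \<longrightarrow> u x = v x) \<and> P u)"
  using assms(1)
proof (induction Z rule: finite_induct)
  case empty
  have "(\<exists>u. (\<forall>x. u x = v x) \<and> P u) \<longleftrightarrow> P v" for v
    by (metis ext)
  then show ?case using assms(2) by simp
next
  case (insert z Z)
  have eq: "(\<exists>a u. (\<forall>x. x \<notin> Z \<longrightarrow> u x = (v(z := a)) x) \<and> P u) \<longleftrightarrow>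
      (\<exists>u. (\<forall>x. x \<notin> insert z Z \<longrightarrow> u x = v x) \<and> P u)" for v
  proof safe
    fix u assume "\<forall>x. x \<notin> insert z Z \<longrightarrow> u x = v x" "P u"
    then show "\<exists>a u. (\<forall>x. x \<notin> Z \<longrightarrow> u x = (v(z := a)) x) \<and> P u"
      by (intro exI[of _ "u z"] exI[of _ u]) auto
  next
    fix u a assume "\<forall>x. x \<notin> Z \<longrightarrow> u x = (v(z := a)) x" "P u"
    then show "\<exists>u. (\<forall>x. x \<notin> insert z Z \<longrightarrow> u x = v x) \<and> P u"
      by (intro exI[of _ u]) auto
  qed
  have "W - Z - {z} = W - insert z Z" by blast
  then show ?case using definable_ex1[OF insert.IH, of z] by (simp only: eq)
qed

section \<open>Translation between definable predicates and formulas with parameters\<close>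

lemma psat_nth:
  assumes "\<phi> \<in> formulas M (length a + length b)"
  shows "psat M a (\<phi>, b) \<longleftrightarrow> sat M ((!) (a @ b)) \<phi>"
  unfolding psat_def holds_def fst_conv snd_conv
  by (rule sat_cong) (use assms in \<open>auto simp: formulas_def\<close>)

lemma psat_Neg: "psat M a (Neg \<phi>, b) \<longleftrightarrow> \<not> psat M a (\<phi>, b)"
  by (simp add: psat_def holds_def)

lemma definable_psat:
  assumes "\<phi> \<in> formulas M (length xs + length b)" "set xs \<subseteq> W" "set b \<subseteq> B"
  shows "definable M B W (\<lambda>v. psat M (map v xs) (\<phi>, b))"
proof (rule definableI[of _ \<phi> "(!) (map Inl xs @ map Inr b)"])
  show "wf_fm M \<phi>" using assms(1) by (simp add: formulas_def)
  show "(!) (map Inl xs @ map Inr b) ` fv \<phi> \<subseteq> W <+> B"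
  proof safe
    fix i assume "i \<in> fv \<phi>"
    then have "(map Inl xs @ map Inr b) ! i \<in> set (map Inl xs @ map Inr b)"
      using assms(1) by (intro nth_mem) (auto simp: formulas_def)
    then show "(map Inl xs @ map Inr b) ! i \<in> W <+> B"
      using assms(2,3) by auto
  qed
  show "psat M (map v xs) (\<phi>, b) \<longleftrightarrow>
    sat M (case_sum v id \<circ> (!) (map Inl xs @ map Inr b)) \<phi>" for v
    unfolding psat_nth[of \<phi> M "map v xs" b, simplified, OF assms(1)]
    by (rule sat_cong) (use assms in \<open>auto simp: formulas_def nth_append\<close>)
qed

text \<open>The finitely many parameters in use are listed as \<open>b\<close>, and each variable of
  the formula is sent to some position of \<open>xs @ b\<close> holding its value. Repetitions in
  \<open>xs\<close> or \<open>b\<close> are harmless, as any such position will do.\<close>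

lemma definable_imp_pformula:
  assumes "definable M B (set xs) P"
  shows "\<exists>\<sigma> \<in> pformulas M (length xs) B. \<forall>v. psat M (map v xs) \<sigma> \<longleftrightarrow> P v"
proof -
  obtain \<phi> \<rho> where \<phi>: "wf_fm M \<phi>" "\<rho> ` fv \<phi> \<subseteq> set xs <+> B"
    "\<forall>v. P v \<longleftrightarrow> sat M (case_sum v id \<circ> \<rho>) \<phi>"
    using assms(1) unfolding definable_def by blast
  have fin: "finite (Inr -` (\<rho> ` fv \<phi>))"
    by (rule finite_vimageI[OF finite_imageI[OF finite_fv] inj_Inr])
  obtain b where b: "set b = Inr -` (\<rho> ` fv \<phi>)"
    using finite_list[OF fin] ..
  let ?ys = "map Inl xs @ map Inr b"
  have "\<exists>j < length ?ys. ?ys ! j = \<rho> i" if "i \<in> fv \<phi>" for i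
  proof -
    have "\<rho> i \<in> set ?ys"
    proof (cases "\<rho> i")
      case (Inl x)
      then show ?thesis using \<phi>(2) that by auto
    next
      case (Inr c)
      then have "c \<in> set b" using that unfolding b by (metis imageI vimage_eq)
      then show ?thesis using Inr by simp
    qed
    then show ?thesis by (simp only: in_set_conv_nth)
  qed
  then obtain f where f: "\<And>i. i \<in> fv \<phi> \<Longrightarrow> f i < length ?ys \<and> ?ys ! f i = \<rho> i"
    by metis
  obtain \<psi> where \<psi>: "wf_fm M \<psi>" "fv \<psi> = f ` fv \<phi>"
    "\<forall>e. sat M e \<psi> \<longleftrightarrow> sat M (e \<circ> f) \<phi>"
    using rename_fm[of M \<phi> f] \<phi>(1) by blast
  have \<psi>_fm: "\<psi> \<in> formulas M (length xs + length b)"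
    using \<psi>(1,2) f by (auto simp: formulas_def)
  have "psat M (map v xs) (\<psi>, b) \<longleftrightarrow> P v" for v
  proof -
    have eq: "map v xs @ b = map (case_sum v id) ?ys" by (simp add: comp_def)
    have "sat M ((!) (map v xs @ b) \<circ> f) \<phi> \<longleftrightarrow> sat M (case_sum v id \<circ> \<rho>) \<phi>"
      unfolding eq by (rule sat_cong) (use f in \<open>auto simp del: map_append\<close>)
    then show ?thesis
      using \<psi>_fm \<psi>(3) \<phi>(3) by (simp add: psat_nth)
  qed
  moreover have "(\<psi>, b) \<in> pformulas M (length xs) B"
    using \<psi>_fm b \<phi>(2) by (auto simp: pformulas_def)
  ultimately show ?thesis by blast
qed

section \<open>Equality of types of tuples\<close>

lemma tp_iff: "\<sigma> \<in> tp M a B \<longleftrightarrow> \<sigma> \<in> pformulas M (length a) B \<and> psat M a \<sigma>"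
  by (simp add: tp_def)

lemma tuple_equiv_psat:
  assumes "tuple_equiv M C l l'" "\<sigma> \<in> pformulas M (length l) C"
  shows "psat M l \<sigma> \<longleftrightarrow> psat M l' \<sigma>"
  using assms unfolding tuple_equiv_def by (metis tp_iff)

text \<open>Equality of types in terms of assignments instead of substituted tuples: permuting,
  repeating or splitting the entries of \<open>l\<close> then needs no syntactic work. Most later
  facts about \<open>tuple_equiv\<close> are instances.\<close>

lemma tuple_equiv_sat:
  assumes "tuple_equiv M C l l'" "wf_fm M \<phi>"
    and "\<And>i. i \<in> fv \<phi> \<Longrightarrow>
      (e i \<in> C \<and> e' i = e i) \<or> (\<exists>j < length l. e i = l ! j \<and> e' i = l' ! j)"
  shows "sat M e \<phi> \<longleftrightarrow> sat M e' \<phi>"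
proof -
  have "\<exists>r. r \<in> {..<length l} <+> C \<and> e i = case_sum ((!) l) id r \<and> e' i = case_sum ((!) l') id r"
    if "i \<in> fv \<phi>" for i
    using assms(3)[OF that]
  proof
    assume "e i \<in> C \<and> e' i = e i"
    then show ?thesis by (intro exI[of _ "Inr (e i)"]) auto
  next
    assume "\<exists>j < length l. e i = l ! j \<and> e' i = l' ! j"
    then obtain j where "j < length l \<and> e i = l ! j \<and> e' i = l' ! j" by blast
    then show ?thesis by (intro exI[of _ "Inl j"]) auto
  qed
  then obtain \<rho> where \<rho>: "\<And>i. i \<in> fv \<phi> \<Longrightarrow> \<rho> i \<in> {..<length l} <+> C \<and>
      e i = case_sum ((!) l) id (\<rho> i) \<and> e' i = case_sum ((!) l') id (\<rho> i)"
    by metis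
  \<comment> \<open>The positions in \<open>l\<close>, not its entries, are the arguments, so
    repeated entries cause no ambiguity.\<close>
  have "definable M C (set [0..<length l]) (\<lambda>v. sat M (case_sum v id \<circ> \<rho>) \<phi>)"
    using assms(2) by (rule definableI) (use \<rho> in \<open>auto simp flip: lessThan_atLeast0\<close>)
  then obtain \<sigma> where \<sigma>: "\<sigma> \<in> pformulas M (length l) C"
    "\<forall>v. psat M (map v [0..<length l]) \<sigma> \<longleftrightarrow> sat M (case_sum v id \<circ> \<rho>) \<phi>"
    using definable_imp_pformula by (metis (no_types, lifting) diff_zero length_upt)
  have "length l' = length l" using assms(1) by (simp add: tuple_equiv_def)
  then have "psat M l \<sigma> \<longleftrightarrow> sat M (case_sum ((!) l) id \<circ> \<rho>) \<phi>"
    "psat M l' \<sigma> \<longleftrightarrow> sat M (case_sum ((!) l') id \<circ> \<rho>) \<phi>"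
    using \<sigma>(2)[rule_format, of "(!) l"] \<sigma>(2)[rule_format, of "(!) l'"] map_nth[of l] map_nth[of l']
    by simp_all
  moreover have "sat M (case_sum ((!) l) id \<circ> \<rho>) \<phi> \<longleftrightarrow> sat M e \<phi>"
    "sat M (case_sum ((!) l') id \<circ> \<rho>) \<phi> \<longleftrightarrow> sat M e' \<phi>"
    by (rule sat_cong; use \<rho> in simp)+
  ultimately show ?thesis
    using tuple_equiv_psat[OF assms(1) \<sigma>(1)] by blast
qed


lemma tuple_equiv_length: "tuple_equiv M C a a' \<Longrightarrow> length a' = length a"
  by (simp add: tuple_equiv_def)

lemma tuple_equiv_sym: "tuple_equiv M C a a' \<Longrightarrow> tuple_equiv M C a' a"
  by (simp add: tuple_equiv_def)

lemma tuple_equiv_trans: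
  "tuple_equiv M C a b \<Longrightarrow> tuple_equiv M C b c \<Longrightarrow> tuple_equiv M C a c"
  by (simp add: tuple_equiv_def)

text \<open>Types of tuples are complete, so applying the hypothesis to negations turns the
  inclusion into an equality.\<close>

lemma tuple_equivI:
  assumes len: "length a' = length a"
    and imp: "\<And>\<phi> b. \<phi> \<in> formulas M (length a + length b) \<Longrightarrow> set b \<subseteq> C \<Longrightarrow>
      psat M a (\<phi>, b) \<Longrightarrow> psat M a' (\<phi>, b)"
  shows "tuple_equiv M C a a'"
proof -
  have "psat M a (\<phi>, b) \<longleftrightarrow> psat M a' (\<phi>, b)"
    if "\<phi> \<in> formulas M (length a + length b)" "set b \<subseteq> C" for \<phi> b
    using imp[of \<phi> b] imp[of "Neg \<phi>" b] that by (auto simp: formulas_def psat_Neg)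
  then show ?thesis
    unfolding tuple_equiv_def using len by (auto simp: tp_def pformulas_def)
qed

lemma tuple_equiv_mono:
  assumes "tuple_equiv M C a a'" "C' \<subseteq> C"
  shows "tuple_equiv M C' a a'"
proof (rule tuple_equivI)
  show "length a' = length a" using assms(1) by (rule tuple_equiv_length)
  fix \<phi> b assume "\<phi> \<in> formulas M (length a + length b)" "set b \<subseteq> C'" "psat M a (\<phi>, b)"
  then show "psat M a' (\<phi>, b)"
    using tuple_equiv_psat[OF assms(1), of "(\<phi>, b)"] assms(2) by (auto simp: pformulas_def)
qed

text \<open>A formula mentions only finitely many parameters. This reduces indiscernibility over an
  infinite set of terms to finite pieces of it.\<close>

lemma tuple_equiv_finite_params:
  assumes "\<And>F. finite F \<Longrightarrow> F \<subseteq> B \<Longrightarrow> tuple_equiv M F a a'"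
  shows "tuple_equiv M B a a'"
proof (rule tuple_equivI)
  show "length a' = length a" using assms[of "{}"] by (simp add: tuple_equiv_length)
  fix \<phi> b assume "\<phi> \<in> formulas M (length a + length b)" "set b \<subseteq> B" "psat M a (\<phi>, b)"
  then show "psat M a' (\<phi>, b)"
    using tuple_equiv_psat[OF assms[of "set b"], of "(\<phi>, b)"] by (auto simp: pformulas_def)
qed

text \<open>Common segments of two tuples of the same type can serve as parameters. There is one
  segment on either side because the tuples will be blocks of an indiscernible sequence with fixed
  terms below and above.\<close>

lemma tuple_equiv_add_params:
  assumes eq: "tuple_equiv M C (U @ X @ Y) (U @ X' @ Y)" and len: "length X' = length X"
  shows "tuple_equiv M (C \<union> set U \<union> set Y) X X'"
proof (rule tuple_equivI)
  fix \<phi> b assume \<phi>: "\<phi> \<in> formulas M (length X + length b)" and b: "set b \<subseteq> C \<union> set U \<union> set Y"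
    and "psat M X (\<phi>, b)"
  have "sat M ((!) (X @ b)) \<phi> \<longleftrightarrow> sat M ((!) (X' @ b)) \<phi>"
  proof (rule tuple_equiv_sat[OF eq])
    show "wf_fm M \<phi>" using \<phi> by (simp add: formulas_def)
    fix i assume "i \<in> fv \<phi>"
    then have i: "i < length X + length b" using \<phi> by (auto simp: formulas_def)
    show "(X @ b) ! i \<in> C \<and> (X' @ b) ! i = (X @ b) ! i \<or>
      (\<exists>j<length (U @ X @ Y). (X @ b) ! i = (U @ X @ Y) ! j \<and> (X' @ b) ! i = (U @ X' @ Y) ! j)"
    proof (cases "i < length X")
      case True
      then show ?thesis
        using len by (intro disjI2 exI[of _ "length U + i"]) (simp add: nth_append)
    next
      case False
      define c where "c = b ! (i - length X)"
      have c: "(X @ b) ! i = c" "(X' @ b) ! i = c"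
        using False len by (auto simp: nth_append c_def)
      have "c \<in> set b" unfolding c_def using False i by (intro nth_mem) auto
      then consider "c \<in> C" | j where "j < length U" "U ! j = c" | j where "j < length Y" "Y ! j = c"
        using b by (metis Un_iff in_set_conv_nth subsetD)
      then show ?thesis
      proof cases
        case 1
        then show ?thesis using c by simp
      next
        case 2
        then show ?thesis
          unfolding c by (intro disjI2 exI[of _ j]) (simp add: nth_append)
      next
        case 3
        then show ?thesis
          unfolding c using len
          by (intro disjI2 exI[of _ "length U + length X + j"]) (simp add: nth_append)
      qed
    qed
  qed
  then show "psat M X' (\<phi>, b)"
    using \<phi> len \<open>psat M X (\<phi>, b)\<close> by (simp add: psat_nth)
qed (rule len)

section \<open>Saturation and homogeneity for tuples and sets\<close>

text \<open>A partial type in possibly infinitely many variables, named by the elements of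
  \<open>'v\<close>; the list in front of a formula tells which variables form its tuple
  \<open>x\<close>.\<close>

definition realizes ::
    "('f, 'r, 'a) model \<Rightarrow> ('v \<Rightarrow> 'a) \<Rightarrow> ('v list \<times> ('f, 'r, 'a) pfm) set \<Rightarrow> bool" where
  "realizes M v \<Sigma> \<longleftrightarrow> (\<forall>(xs, \<sigma>) \<in> \<Sigma>. psat M (map v xs) \<sigma>)"

lemma definable_realizes:
  assumes "finite \<Sigma>" "\<And>xs \<sigma>. (xs, \<sigma>) \<in> \<Sigma> \<Longrightarrow> set xs \<subseteq> W \<and> \<sigma> \<in> pformulas M (length xs) B"
  shows "definable M B W (\<lambda>v. realizes M v \<Sigma>)"
proof -
  have "definable M B W (\<lambda>v. \<forall>p \<in> \<Sigma>. psat M (map v (fst p)) (snd p))"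
  proof (rule definable_ball[OF assms(1)])
    fix p assume "p \<in> \<Sigma>"
    then have "set (fst p) \<subseteq> W" "snd p \<in> pformulas M (length (fst p)) B"
      using assms(2)[of "fst p" "snd p"] by simp_all
    then show "definable M B W (\<lambda>v. psat M (map v (fst p)) (snd p))"
      using definable_psat[of "fst (snd p)" M "fst p" "snd (snd p)" W B]
      by (auto simp: pformulas_def)
  qed
  then show ?thesis by (simp add: realizes_def case_prod_beta)
qed

lemma small_Un:
  assumes "Card_order \<kappa>" "infinite (Field \<kappa>)" "small \<kappa> A" "small \<kappa> B"
  shows "small \<kappa> (A \<union> B)"
  using assms unfolding small_def by (rule_tac card_of_Un_ordLess_infinite_Field)

lemma small_image: "small \<kappa> A \<Longrightarrow> small \<kappa> (f ` A)"
  unfolding small_def using card_of_image ordLeq_ordLess_trans by blast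

text \<open>
  Zorn's lemma is applied to the graphs of finitely satisfiable partial assignments. Their
  ranges are small throughout because the variables form a small set, so \<open>\<kappa>\<close> need not be
  regular.
\<close>

lemma saturated_realizes:
  fixes M :: "('f, 'r, 'a) model" and V :: "'v set"
  assumes sat: "saturated \<kappa> M" and \<kappa>: "Card_order \<kappa>" "infinite (Field \<kappa>)"
    and V: "small \<kappa> V" and B: "small \<kappa> B"
    and \<Sigma>: "\<And>xs \<sigma>. (xs, \<sigma>) \<in> \<Sigma> \<Longrightarrow> set xs \<subseteq> V \<and> \<sigma> \<in> pformulas M (length xs) B"
    and fs: "\<And>\<Sigma>\<^sub>0. finite \<Sigma>\<^sub>0 \<Longrightarrow> \<Sigma>\<^sub>0 \<subseteq> \<Sigma> \<Longrightarrow> \<exists>v. realizes M v \<Sigma>\<^sub>0"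
  shows "\<exists>v. realizes M v \<Sigma>"
proof -
  define ok where "ok G \<Sigma>\<^sub>0 v \<longleftrightarrow> (\<forall>p\<in>G. v (fst p) = snd p) \<and> realizes M v \<Sigma>\<^sub>0"
    for G \<Sigma>\<^sub>0 and v :: "'v \<Rightarrow> 'a"
  define \<F> where "\<F> = {G. G \<subseteq> V \<times> UNIV \<and>
    (\<forall>G\<^sub>0 \<Sigma>\<^sub>0. finite G\<^sub>0 \<and> G\<^sub>0 \<subseteq> G \<and> finite \<Sigma>\<^sub>0 \<and> \<Sigma>\<^sub>0 \<subseteq> \<Sigma> \<longrightarrow> (\<exists>v. ok G\<^sub>0 \<Sigma>\<^sub>0 v))}"
  have "\<exists>G\<in>\<F>. \<forall>X\<in>\<F>. G \<subseteq> X \<longrightarrow> X = G"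
  proof (rule subset_Zorn_nonempty)
    have "{} \<in> \<F>" using fs by (auto simp: \<F>_def ok_def)
    then show "\<F> \<noteq> {}" by blast
    fix \<C> assume \<C>: "\<C> \<noteq> {}" "subset.chain \<F> \<C>"
    then have sub: "\<C> \<subseteq> \<F>" by (simp add: subset.chain_def)
    have "\<exists>v. ok G\<^sub>0 \<Sigma>\<^sub>0 v" if G\<^sub>0: "finite G\<^sub>0" "G\<^sub>0 \<subseteq> \<Union>\<C>" and "finite \<Sigma>\<^sub>0" "\<Sigma>\<^sub>0 \<subseteq> \<Sigma>" for G\<^sub>0 \<Sigma>\<^sub>0
    proof -
      obtain G where "G \<in> \<C>" "G\<^sub>0 \<subseteq> G"
        by (rule finite_subset_Union_chain[OF G\<^sub>0 \<C>])
      moreover from this have "G \<in> \<F>" using sub by blast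
      ultimately show ?thesis using that unfolding \<F>_def by blast
    qed
    moreover have "\<Union>\<C> \<subseteq> V \<times> UNIV" using sub unfolding \<F>_def by blast
    ultimately show "\<Union>\<C> \<in> \<F>" by (simp add: \<F>_def)
  qed
  then obtain G where G: "G \<in> \<F>" and max: "\<And>X. X \<in> \<F> \<Longrightarrow> G \<subseteq> X \<Longrightarrow> X = G" by blast
  have G_V: "G \<subseteq> V \<times> UNIV" using G by (simp add: \<F>_def)
  have G_ok: "\<exists>v. ok G\<^sub>0 \<Sigma>\<^sub>0 v" if "finite G\<^sub>0" "G\<^sub>0 \<subseteq> G" "finite \<Sigma>\<^sub>0" "\<Sigma>\<^sub>0 \<subseteq> \<Sigma>" for G\<^sub>0 \<Sigma>\<^sub>0
    using G that by (simp add: \<F>_def)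
  have single: "c = c'" if "(x, c) \<in> G" "(x, c') \<in> G" for x c c'
    using G_ok[of "{(x, c), (x, c')}" "{}"] that by (auto simp: ok_def)
  define g where "g x = (SOME c. (x, c) \<in> G)" for x
  have g: "g x = c" if "(x, c) \<in> G" for x c
    unfolding g_def using that single by blast
  \<comment> \<open>Off the domain of \<open>G\<close> the function \<open>g\<close> has arbitrary
    values; they only add parameters, and the set stays small.\<close>
  let ?B = "B \<union> g ` V"
  have small: "small \<kappa> ?B" using \<kappa> B V by (intro small_Un small_image)
  have total: "\<exists>a. (x, a) \<in> G" if "x \<in> V" for x
  proof -
    \<comment> \<open>The indices are the finite demands on an assignment extending
      \<open>G\<close>. Each of them restricts the value of \<open>x\<close> by a single formula in
      one variable, to which saturation applies.\<close>
    define I where "I = {i. finite (fst i) \<and> fst i \<subseteq> G \<and> finite (snd i) \<and> snd i \<subseteq> \<Sigma>}"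
    have "\<exists>\<sigma>. \<sigma> \<in> pformulas M 1 ?B \<and>
        (\<forall>a. psat M [a] \<sigma> \<longleftrightarrow> (\<exists>v. v x = a \<and> ok (fst i) (snd i) v))" if "i \<in> I" for i
    proof -
      obtain G\<^sub>0 \<Sigma>\<^sub>0 where i: "i = (G\<^sub>0, \<Sigma>\<^sub>0)" by fastforce
      have fin: "finite G\<^sub>0" "G\<^sub>0 \<subseteq> G" "finite \<Sigma>\<^sub>0" "\<Sigma>\<^sub>0 \<subseteq> \<Sigma>"
        using that by (auto simp: I_def i)
      define W where "W = insert x (fst ` G\<^sub>0 \<union> (\<Union>p\<in>\<Sigma>\<^sub>0. set (fst p)))"
      have W: "finite W" "x \<in> W" using fin by (auto simp: W_def)
      have def: "definable M ?B W (ok G\<^sub>0 \<Sigma>\<^sub>0)"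
        unfolding ok_def
      proof (intro definable_conj definable_ball definable_eq definable_realizes fin)
        fix p assume "p \<in> G\<^sub>0"
        then have "(fst p, snd p) \<in> G" using fin(2) by auto
        then show "snd p \<in> ?B" using g G_V by (metis UnI2 imageI mem_Sigma_iff subsetD)
        show "fst p \<in> W" using \<open>p \<in> G\<^sub>0\<close> by (auto simp: W_def)
      next
        fix xs \<sigma> assume "(xs, \<sigma>) \<in> \<Sigma>\<^sub>0"
        then show "set xs \<subseteq> W \<and> \<sigma> \<in> pformulas M (length xs) ?B"
          using \<Sigma>[of xs \<sigma>] fin(4) by (force simp: W_def pformulas_def)
      qed
      \<comment> \<open>All variables except \<open>x\<close> are quantified away.\<close>
      have "W - (W - {x}) = set [x]" using W(2) by auto
      with definable_ex[OF finite_Diff[OF W(1)] def, of "{x}"]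
      have "definable M ?B (set [x]) (\<lambda>v. \<exists>u. (\<forall>z. z \<notin> W - {x} \<longrightarrow> u z = v z) \<and> ok G\<^sub>0 \<Sigma>\<^sub>0 u)"
        by (simp only:)
      from definable_imp_pformula[OF this] obtain \<sigma> where \<sigma>: "\<sigma> \<in> pformulas M (length [x]) ?B"
        "\<forall>v. psat M (map v [x]) \<sigma> \<longleftrightarrow> (\<exists>u. (\<forall>z. z \<notin> W - {x} \<longrightarrow> u z = v z) \<and> ok G\<^sub>0 \<Sigma>\<^sub>0 u)"
        by blast
      have "psat M [a] \<sigma> \<longleftrightarrow> (\<exists>v. v x = a \<and> ok G\<^sub>0 \<Sigma>\<^sub>0 v)" for a
      proof
        assume "psat M [a] \<sigma>"
        then show "\<exists>v. v x = a \<and> ok G\<^sub>0 \<Sigma>\<^sub>0 v"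
          using \<sigma>(2)[rule_format, of "\<lambda>_. a"] by auto
      next
        assume "\<exists>v. v x = a \<and> ok G\<^sub>0 \<Sigma>\<^sub>0 v"
        then obtain v where v: "v x = a" "ok G\<^sub>0 \<Sigma>\<^sub>0 v" by blast
        \<comment> \<open>Outside \<open>W\<close> the quantified predicate demands agreement with
          the constant assignment \<open>\<lambda>_. a\<close>, hence the default value.\<close>
        let ?u = "\<lambda>z. if z \<in> W then v z else a"
        have "ok G\<^sub>0 \<Sigma>\<^sub>0 ?u" using definable_cong[OF def, of ?u v] v(2) by simp
        moreover have "\<forall>z. z \<notin> W - {x} \<longrightarrow> ?u z = a" using v(1) by simp
        ultimately have "psat M (map (\<lambda>_. a) [x]) \<sigma>"
          unfolding \<sigma>(2)[rule_format] by (intro exI[of _ ?u]) simp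
        then show "psat M [a] \<sigma>" by simp
      qed
      then show ?thesis using \<sigma>(1) i by (intro exI[of _ \<sigma>]) simp
    qed
    then obtain \<tau> where \<tau>: "\<And>i. i \<in> I \<Longrightarrow> \<tau> i \<in> pformulas M 1 ?B"
      "\<And>i a. i \<in> I \<Longrightarrow> psat M [a] (\<tau> i) \<longleftrightarrow> (\<exists>v. v x = a \<and> ok (fst i) (snd i) v)"
      by metis
    have "consistent M 1 (\<tau> ` I)"
      unfolding consistent_def
    proof (intro allI impI)
      fix S assume "finite S \<and> S \<subseteq> \<tau> ` I"
      then obtain J where J: "J \<subseteq> I" "finite J" "S = \<tau> ` J"
        by (metis finite_subset_image)
      \<comment> \<open>Finitely many finite demands together form one finite demand, so a single
        assignment meets them all.\<close>
      have "\<exists>v. ok (\<Union>i\<in>J. fst i) (\<Union>i\<in>J. snd i) v"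
      proof (rule G_ok)
        show "finite (\<Union>i\<in>J. fst i)" "(\<Union>i\<in>J. fst i) \<subseteq> G"
          "finite (\<Union>i\<in>J. snd i)" "(\<Union>i\<in>J. snd i) \<subseteq> \<Sigma>"
          using J(1,2) unfolding I_def by blast+
      qed
      then obtain v where v: "ok (\<Union>i\<in>J. fst i) (\<Union>i\<in>J. snd i) v" by blast
      have "ok (fst i) (snd i) v" if "i \<in> J" for i
        using v that unfolding ok_def realizes_def by blast
      then show "\<exists>a. length a = 1 \<and> (\<forall>\<sigma>\<in>S. psat M a \<sigma>)"
        unfolding J(3) using \<tau>(2) J(1) by (intro exI[of _ "[v x]"]) fastforce
    qed
    moreover have "\<tau> ` I \<subseteq> pformulas M 1 ?B" using \<tau>(1) by blast
    ultimately obtain a where a: "\<And>i. i \<in> I \<Longrightarrow> psat M [a] (\<tau> i)"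
      using sat small unfolding saturated_def by (metis imageI)
    have "\<exists>v. ok G\<^sub>0 \<Sigma>\<^sub>0 v"
      if "finite G\<^sub>0" "G\<^sub>0 \<subseteq> insert (x, a) G" "finite \<Sigma>\<^sub>0" "\<Sigma>\<^sub>0 \<subseteq> \<Sigma>" for G\<^sub>0 \<Sigma>\<^sub>0
    proof -
      have i: "(G\<^sub>0 - {(x, a)}, \<Sigma>\<^sub>0) \<in> I" using that by (auto simp: I_def)
      then obtain v where "v x = a" "ok (G\<^sub>0 - {(x, a)}) \<Sigma>\<^sub>0 v"
        using a[OF i] \<tau>(2)[OF i] by auto
      then have "ok G\<^sub>0 \<Sigma>\<^sub>0 v" by (auto simp: ok_def)
      then show ?thesis by blast
    qed
    then have "insert (x, a) G \<in> \<F>" using G_V \<open>x \<in> V\<close> unfolding \<F>_def by simp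
    then show ?thesis using max[of "insert (x, a) G"] by blast
  qed
  have "realizes M g \<Sigma>"
    unfolding realizes_def
  proof safe
    fix xs \<phi> b assume mem: "(xs, \<phi>, b) \<in> \<Sigma>"
    have "(\<lambda>x. (x, g x)) ` set xs \<subseteq> G"
      using \<Sigma>[OF mem] total g by fastforce
    then obtain v where v: "ok ((\<lambda>x. (x, g x)) ` set xs) {(xs, \<phi>, b)} v"
      using G_ok[of "(\<lambda>x. (x, g x)) ` set xs" "{(xs, \<phi>, b)}"] mem by auto
    then have "map v xs = map g xs" by (simp add: ok_def)
    then show "psat M (map g xs) (\<phi>, b)"
      using v by (simp add: ok_def realizes_def del: map_eq_conv)
  qed
  then show ?thesis by blast
qed

section \<open>Automorphisms\<close>

lemma automorphism_eval:
  assumes "automorphism M h" "wf_tm M t"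
  shows "eval M (\<lambda>i. h (e i)) t = h (eval M e t)"
  using assms(2)
proof (induction t)
  case (Fun f ts)
  then have "map (eval M (\<lambda>i. h (e i))) ts = map h (map (eval M e) ts)"
    by (auto simp: list_all_iff)
  then show ?case
    using assms(1) Fun.prems by (simp add: automorphism_def del: map_map map_eq_conv)
qed simp

lemma automorphism_sat:
  assumes "automorphism M h" "wf_fm M \<phi>"
  shows "sat M (\<lambda>i. h (e i)) \<phi> \<longleftrightarrow> sat M e \<phi>"
  using assms(2)
proof (induction \<phi> arbitrary: e)
  case (Eq t u)
  have "inj h" using assms(1) by (simp add: automorphism_def bij_is_inj)
  then show ?case using Eq automorphism_eval[OF assms(1)] by (simp add: inj_eq)
next
  case (Rel r ts)
  then have "map (eval M (\<lambda>i. h (e i))) ts = map h (map (eval M e) ts)"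
    using automorphism_eval[OF assms(1)] by (auto simp: list_all_iff)
  then show ?case
    using assms(1) Rel.prems by (simp add: automorphism_def del: map_map map_eq_conv)
next
  case (Ex i \<phi>)
  have "surj h" using assms(1) by (simp add: automorphism_def bij_is_surj)
  then have "(\<exists>x. sat M ((\<lambda>i. h (e i))(i := x)) \<phi>) \<longleftrightarrow>
      (\<exists>x. sat M ((\<lambda>i. h (e i))(i := h x)) \<phi>)"
    by (metis surjD)
  moreover have "(\<lambda>i. h (e i))(i := h x) = (\<lambda>k. h ((e(i := x)) k))" for x
    by auto
  moreover have "sat M (\<lambda>k. h ((e(i := x)) k)) \<phi> \<longleftrightarrow> sat M (e(i := x)) \<phi>" for x
    by (rule Ex.IH) (use Ex.prems in simp)
  ultimately show ?case by (simp only: sat.simps)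
qed simp_all

lemma automorphism_psat:
  assumes "automorphism M h" "\<phi> \<in> formulas M (length a + length b)"
  shows "psat M (map h a) (\<phi>, map h b) \<longleftrightarrow> psat M a (\<phi>, b)"
proof -
  have "sat M ((!) (map h a @ map h b)) \<phi> \<longleftrightarrow> sat M (\<lambda>i. h ((a @ b) ! i)) \<phi>"
    by (rule sat_cong) (use assms(2) in \<open>auto simp: formulas_def nth_append\<close>)
  then show ?thesis
    using automorphism_sat[OF assms(1)] assms(2) by (simp add: psat_nth formulas_def)
qed

text \<open>Homogeneity speaks of a map on a set, so the map fixing \<open>C\<close> and sending
  \<open>l\<close> to \<open>l'\<close> entrywise must be well defined. Entries of \<open>l\<close>
  may repeat or lie in \<open>C\<close>, but such coincidences are equations in the type of
  \<open>l\<close> over \<open>C\<close>, so \<open>l'\<close> satisfies them too.\<close>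

lemma strongly_homogeneous_tuple:
  fixes M :: "('f, 'r, 'a) model"
  assumes "strongly_homogeneous \<kappa> M" "small \<kappa> (C \<union> set l)" "tuple_equiv M C l l'"
  shows "\<exists>h. automorphism M h \<and> (\<forall>c \<in> C. h c = c) \<and> map h l = l'"
proof -
  define k where "k x = (SOME j. j < length l \<and> l ! j = x)" for x
  define g where "g x = (if x \<in> C then x else l' ! k x)" for x
  have g_nth: "g (l ! j) = l' ! j" if "j < length l" for j
  proof (cases "l ! j \<in> C")
    case True
    have "sat M (\<lambda>i. l ! j) (Eq (Var 0) (Var 1)) \<longleftrightarrow>
        sat M (\<lambda>i. if i = 0 then l ! j else l' ! j) (Eq (Var 0) (Var 1))"
      by (rule tuple_equiv_sat[OF assms(3)]) (use True that in auto)
    then show ?thesis using True by (simp add: g_def)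
  next
    case False
    have k: "k (l ! j) < length l \<and> l ! k (l ! j) = l ! j"
      unfolding k_def using someI[of "\<lambda>i. i < length l \<and> l ! i = l ! j"] that by blast
    have "sat M (\<lambda>i. l ! j) (Eq (Var 0) (Var 1)) \<longleftrightarrow>
        sat M (\<lambda>i. l' ! (if i = 0 then k (l ! j) else j)) (Eq (Var 0) (Var 1))"
      by (rule tuple_equiv_sat[OF assms(3)]) (use k that in auto)
    then show ?thesis using False by (simp add: g_def)
  qed
  have "elementary_on M {} (C \<union> set l) g"
    unfolding elementary_on_def
  proof (intro allI impI tuple_equivI)
    fix a b :: "'a list" and \<phi>
    assume a: "set a \<subseteq> C \<union> set l" and "set b \<subseteq> {}"
      and \<phi>: "\<phi> \<in> formulas M (length a + length b)" and psat: "psat M a (\<phi>, b)"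
    then have b: "b = []" by simp
    have "sat M ((!) a) \<phi> \<longleftrightarrow> sat M ((!) (map g a)) \<phi>"
    proof (rule tuple_equiv_sat[OF assms(3)])
      fix i assume "i \<in> fv \<phi>"
      then have i: "i < length a" using \<phi> b by (auto simp: formulas_def)
      then have "a ! i \<in> C \<or> a ! i \<in> set l" using a nth_mem by blast
      then show "a ! i \<in> C \<and> map g a ! i = a ! i \<or>
          (\<exists>j<length l. a ! i = l ! j \<and> map g a ! i = l' ! j)"
        using i g_nth by (metis g_def in_set_conv_nth nth_map)
    qed (use \<phi> in \<open>simp add: formulas_def\<close>)
    then show "psat M (map g a) (\<phi>, b)" using psat \<phi> b by (simp add: psat_nth)
  qed simp
  then obtain h where h: "automorphism M h" "\<forall>x \<in> C \<union> set l. h x = g x"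
    using assms(1,2) unfolding strongly_homogeneous_def by blast
  have "map h l = l'"
    using tuple_equiv_length[OF assms(3)] h(2) g_nth by (intro nth_equalityI) auto
  then show ?thesis using h by (auto simp: g_def)
qed


lemma automorphism_tuple_equiv:
  assumes "automorphism M h" "\<And>c. c \<in> C \<Longrightarrow> h c = c"
  shows "tuple_equiv M C l (map h l)"
proof (rule tuple_equivI)
  fix \<phi> b assume \<phi>: "\<phi> \<in> formulas M (length l + length b)" "psat M l (\<phi>, b)" and "set b \<subseteq> C"
  then have "map h b = b" using assms(2) by (intro map_idI) auto
  then show "psat M (map h l) (\<phi>, b)" using automorphism_psat[OF assms(1)] \<phi> by metis
qed simp

lemma tuple_equiv_subtuple:
  assumes eq: "tuple_equiv M C l l'" and a: "set a \<subseteq> set l"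
  shows "\<exists>a'. set a' \<subseteq> set l' \<and> tuple_equiv M C a a'"
proof -
  have "\<forall>x \<in> set l. \<exists>j < length l. l ! j = x" by (simp add: in_set_conv_nth)
  then obtain f where f: "\<And>x. x \<in> set l \<Longrightarrow> f x < length l \<and> l ! f x = x" by metis
  let ?a' = "map (\<lambda>x. l' ! f x) a"
  have "tuple_equiv M C a ?a'"
  proof (rule tuple_equivI)
    fix \<phi> b assume \<phi>: "\<phi> \<in> formulas M (length a + length b)" and b: "set b \<subseteq> C"
      and "psat M a (\<phi>, b)"
    have "sat M ((!) (a @ b)) \<phi> \<longleftrightarrow> sat M ((!) (?a' @ b)) \<phi>"
    proof (rule tuple_equiv_sat[OF eq])
      fix i assume "i \<in> fv \<phi>"
      then have i: "i < length a + length b" using \<phi> by (auto simp: formulas_def)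
      show "(a @ b) ! i \<in> C \<and> (?a' @ b) ! i = (a @ b) ! i \<or>
          (\<exists>j<length l. (a @ b) ! i = l ! j \<and> (?a' @ b) ! i = l' ! j)"
      proof (cases "i < length a")
        case True
        then have "a ! i \<in> set l" using a nth_mem by blast
        then show ?thesis
          using True f[of "a ! i"]
          by (intro disjI2 exI[of _ "f (a ! i)"]) (simp add: nth_append)
      next
        case False
        then have "b ! (i - length a) \<in> C" using b i nth_mem[of "i - length a" b] by auto
        then show ?thesis using False by (simp add: nth_append)
      qed
    qed (use \<phi> in \<open>simp add: formulas_def\<close>)
    then show "psat M ?a' (\<phi>, b)" using \<phi> \<open>psat M a (\<phi>, b)\<close> by (simp add: psat_nth)
  qed simp
  moreover have "set ?a' \<subseteq> set l'"
    using f a tuple_equiv_length[OF eq] by (auto intro!: nth_mem)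
  ultimately show ?thesis by blast
qed

section \<open>Small sets in monster models\<close>

text \<open>The equations \<open>Eq (Var n) (Var n)\<close> alone are infinitely many formulas, so
  \<open>\<kappa>\<close>, being larger than the set of formulas, is uncountable.\<close>

lemma monster_card_nat:
  assumes "monster_model \<kappa> (M :: ('f, 'r, 'a) model) T"
  shows "|UNIV :: nat set| <o \<kappa>"
proof -
  have "inj (\<lambda>n. Eq (Var n) (Var n) :: ('f, 'r) fm)" by (simp add: inj_def)
  moreover have "range (\<lambda>n. Eq (Var n) (Var n)) \<subseteq> {\<phi> :: ('f, 'r) fm. wf_fm M \<phi>}" by auto
  ultimately have "|UNIV :: nat set| \<le>o |{\<phi> :: ('f, 'r) fm. wf_fm M \<phi>}|"
    by (metis card_of_ordLeq)
  then show ?thesis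
    using assms unfolding monster_model_def by (metis ordLeq_ordLess_trans)
qed

lemma monster_infinite:
  assumes "monster_model \<kappa> M T"
  shows "Card_order \<kappa>" "infinite (Field \<kappa>)"
proof -
  show \<kappa>: "Card_order \<kappa>" using assms by (simp add: monster_model_def)
  have "|UNIV :: nat set| \<le>o |Field \<kappa>|"
    using monster_card_nat[OF assms] card_of_Field_ordIso[OF \<kappa>]
    by (meson ordIso_symmetric ordLess_imp_ordLeq ordLess_ordIso_trans)
  then show "infinite (Field \<kappa>)" by (simp add: infinite_iff_card_of_nat)
qed

lemma monster_small_Un:
  "monster_model \<kappa> M T \<Longrightarrow> small \<kappa> A \<Longrightarrow> small \<kappa> B \<Longrightarrow> small \<kappa> (A \<union> B)"
  by (intro small_Un monster_infinite)

lemma small_countable: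
  assumes "monster_model \<kappa> M T" "countable A"
  shows "small \<kappa> A"
proof -
  obtain f :: "_ \<Rightarrow> nat" where "inj_on f A" using assms(2) by (auto simp: countable_def)
  then have "|A| \<le>o |UNIV :: nat set|" by (metis card_of_ordLeq subset_UNIV)
  then show ?thesis
    unfolding small_def using monster_card_nat[OF assms(1)] by (rule ordLeq_ordLess_trans)
qed

lemma card_of_finite_ordLeq_infinite: "finite A \<Longrightarrow> infinite B \<Longrightarrow> |A| \<le>o |B|"
  using card_of_ordLeq_finite ordLeq_total[OF card_of_Well_order card_of_Well_order] by blast

lemma card_of_lists_ordLeq:
  assumes X: "infinite X" and B: "|B| \<le>o |X|"
  shows "|{xs. set xs \<subseteq> B}| \<le>o |X|"
proof -
  have X': "infinite (Field |X| )" "Card_order |X|" using X by (simp_all add: card_of_card_order_on Field_card_of)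
  have "|{xs. length xs = n \<and> set xs \<subseteq> B}| \<le>o |X|" for n
  proof (induction n)
    case 0
    have "{xs. length xs = 0 \<and> set xs \<subseteq> B} = {[]}" by auto
    then show ?case
      using card_of_finite_ordLeq_infinite[OF _ X, of "{[]}"] by simp
  next
    case (Suc n)
    have "{xs. length xs = Suc n \<and> set xs \<subseteq> B} =
        (\<lambda>(x, xs). x # xs) ` (B \<times> {xs. length xs = n \<and> set xs \<subseteq> B})"
      by (auto simp: length_Suc_conv image_iff)
    then show ?case
      using ordLeq_transitive[OF card_of_image card_of_Times_ordLeq_infinite_Field[OF X'(1) B Suc X'(2)]]
      by simp
  qed
  then have "|\<Union>n. {xs. length xs = n \<and> set xs \<subseteq> B}| \<le>o |X|"
    using X by (intro card_of_UNION_ordLeq_infinite) (simp_all flip: infinite_iff_card_of_nat)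
  moreover have "(\<Union>n. {xs. length xs = n \<and> set xs \<subseteq> B}) = {xs. set xs \<subseteq> B}" by auto
  ultimately show ?thesis by simp
qed

lemma small_acl:
  fixes M :: "('f, 'r, 'a) model"
  assumes M: "monster_model \<kappa> M T" and B: "small \<kappa> B"
  shows "small \<kappa> (acl M B)"
proof -
  let ?W = "{\<phi> :: ('f, 'r) fm. wf_fm M \<phi>}"
  let ?X = "B <+> ?W"
  have W: "|?W| <o \<kappa>" using M by (simp add: monster_model_def)
  have "infinite ?W"
  proof
    assume "finite ?W"
    then have "finite (range (\<lambda>n. Eq (Var n) (Var n) :: ('f, 'r) fm))"
      by (rule rev_finite_subset) auto
    moreover have "inj (\<lambda>n. Eq (Var n) (Var n) :: ('f, 'r) fm)" by (simp add: inj_def)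
    ultimately show False using finite_imageD by blast
  qed
  then have X: "infinite ?X" by (simp add: finite_Plus_iff)
  have "|?X| <o \<kappa>"
    using monster_infinite[OF M] B W
    by (intro card_of_Plus_ordLess_infinite_Field) (simp_all add: small_def)
  moreover have "|acl M B| \<le>o |?X|"
  proof -
    \<comment> \<open>Non-algebraic formulas contribute the empty set, so \<open>acl M B\<close> is
      covered by finite sets indexed by formulas over \<open>B\<close>. Counting these indices
      bounds it by \<open>?X\<close>, which is below \<open>\<kappa>\<close>.\<close>
    let ?S = "\<lambda>\<sigma>. if finite {a. psat M [a] \<sigma>} then {a. psat M [a] \<sigma>} else {}"
    have "|?W \<times> {b. set b \<subseteq> B}| \<le>o |?X|"
      using X by (intro card_of_Times_ordLeq_infinite_Field card_of_lists_ordLeq)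
        (simp_all add: card_of_Plus1 card_of_Plus2 card_of_card_order_on Field_card_of)
    moreover have "pformulas M 1 B \<subseteq> ?W \<times> {b. set b \<subseteq> B}"
      by (auto simp: pformulas_def formulas_def)
    ultimately have "|pformulas M 1 B| \<le>o |?X|"
      using card_of_mono1 ordLeq_transitive by blast
    moreover have "\<forall>\<sigma> \<in> pformulas M 1 B. |?S \<sigma>| \<le>o |?X|"
      using X by (auto intro!: card_of_finite_ordLeq_infinite)
    ultimately have "|\<Union>\<sigma> \<in> pformulas M 1 B. ?S \<sigma>| \<le>o |?X|"
      by (rule card_of_UNION_ordLeq_infinite[OF X])
    moreover have "acl M B \<subseteq> (\<Union>\<sigma> \<in> pformulas M 1 B. ?S \<sigma>)"
      by (auto simp: acl_def)
    ultimately show ?thesis using card_of_mono1 ordLeq_transitive by blast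
  qed
  ultimately show ?thesis unfolding small_def by (metis ordLeq_ordLess_trans)
qed

lemma subset_acl: "B \<subseteq> acl M B"
proof
  fix c assume "c \<in> B"
  then have "(Eq (Var 0) (Var 1), [c]) \<in> pformulas M 1 B"
    by (simp add: pformulas_def formulas_def)
  moreover have "psat M [a] (Eq (Var 0) (Var 1), [c]) \<longleftrightarrow> a = c" for a
    by (simp add: psat_def holds_def)
  ultimately show "c \<in> acl M B" unfolding acl_def by (auto intro!: bexI[rotated])
qed

section \<open>Extension for forking independence\<close>

lemma dividesE:
  assumes "divides M n C (\<phi>, b)"
  obtains s where "indiscernible M C s" "\<forall>i. tuple_equiv M C (s i) b"
    "\<not> consistent M n (range (\<lambda>i. (\<phi>, s i)))"
  using assms by (auto simp: divides_def)

text \<open>The same sequence is a witness: restricting the parameters keeps both its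
  indiscernibility and the type of its terms. Together with \<open>kim_divides_imp_divides\<close>
  this makes the choice of a larger base harmless.\<close>

lemma divides_mono:
  assumes "divides M n D \<sigma>" "C \<subseteq> D"
  shows "divides M n C \<sigma>"
proof -
  obtain \<phi> b where \<sigma>: "\<sigma> = (\<phi>, b)" by fastforce
  obtain s where s: "indiscernible M D s" "\<forall>i. tuple_equiv M D (s i) b"
    "\<not> consistent M n (range (\<lambda>i. (\<phi>, s i)))"
    using assms(1) by (auto simp: divides_def \<sigma>)
  have "indiscernible M C s" "\<forall>i. tuple_equiv M C (s i) b"
    using s(1,2) assms(2) unfolding indiscernible_def by (blast intro: tuple_equiv_mono)+
  then show ?thesis using s(3) by (auto simp: divides_def \<sigma>)
qed

lemma divides_imp_forks: "divides M n C \<sigma> \<Longrightarrow> \<sigma> \<in> pformulas M n UNIV \<Longrightarrow> forks M n C \<sigma>"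
  unfolding forks_def by (intro exI[of _ "{\<sigma>}"]) auto

lemma kim_divides_imp_divides: "kim_divides M n C \<sigma> \<Longrightarrow> divides M n C \<sigma>"
  by (auto simp: kim_divides_def divides_def morley_sequence_def)

lemma ex_map_distinct:
  assumes "distinct ws" "length a = length ws"
  shows "\<exists>v. map v ws = a"
proof (intro exI nth_equalityI)
  show "map (\<lambda>x. the (map_of (zip ws a) x)) ws ! i = a ! i"
    if "i < length (map (\<lambda>x. the (map_of (zip ws a) x)) ws)" for i
    using that assms by (simp add: map_of_zip_nth)
qed (simp add: assms)

text \<open>The new formula must not depend on \<open>b\<close>, since it will be evaluated along a
  whole indiscernible sequence. Therefore the parameters are treated as further variables, those
  tagged \<open>Inr\<close>, and the translation takes place over the empty set.\<close>

lemma psat_change_variables: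
  fixes M :: "('f, 'r, 'a) model" and ws :: "'v list"
  assumes "\<phi> \<in> formulas M (length zs + m)" "set zs \<subseteq> set ws"
  shows "\<exists>\<phi>' \<in> formulas M (length ws + m).
    \<forall>v b. length b = m \<longrightarrow> (psat M (map v ws) (\<phi>', b) \<longleftrightarrow> psat M (map v zs) (\<phi>, b))"
proof -
  let ?xs = "map Inl ws @ map Inr [0..<m] :: ('v + nat) list"
  let ?ys = "map Inl zs @ map Inr [0..<m] :: ('v + nat) list"
  have "definable M {} (set ?xs) (\<lambda>u. psat M (map u ?ys) (\<phi>, []))"
    by (rule definable_psat) (use assms in auto)
  from definable_imp_pformula[OF this] obtain \<sigma> where \<sigma>: "\<sigma> \<in> pformulas M (length ?xs) {}"
    "\<forall>u. psat M (map u ?xs) \<sigma> \<longleftrightarrow> psat M (map u ?ys) (\<phi>, [])" by blast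
  obtain \<phi>' where \<phi>': "\<sigma> = (\<phi>', [])" "\<phi>' \<in> formulas M (length ws + m)"
    using \<sigma>(1) by (auto simp: pformulas_def)
  have "psat M (map v ws) (\<phi>', b) \<longleftrightarrow> psat M (map v zs) (\<phi>, b)" if "length b = m" for v b
  proof -
    have "map (case_sum v ((!) b)) (map Inl xs @ map Inr [0..<m]) = map v xs @ b" for xs
      using that map_nth[of b] by (simp add: comp_def)
    then show ?thesis
      using \<sigma>(2)[rule_format, of "case_sum v ((!) b)"] \<phi>'(1) by (simp only: psat_def fst_conv snd_conv append_Nil2)
  qed
  then show ?thesis using \<phi>'(2) by blast
qed

text \<open>The sequence is kept. As \<open>ws\<close> is distinct, any solution in the variables
  \<open>ws\<close> comes from an assignment, whose values on \<open>zs\<close> solve the original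
  instances.\<close>

lemma divides_change_variables:
  assumes "divides M (length zs) C (\<phi>, b)" "distinct ws"
    and eq: "\<And>v b'. length b' = length b \<Longrightarrow>
      psat M (map v ws) (\<phi>', b') \<longleftrightarrow> psat M (map v zs) (\<phi>, b')"
  shows "divides M (length ws) C (\<phi>', b)"
proof -
  obtain s where s: "indiscernible M C s" "\<forall>i. tuple_equiv M C (s i) b"
    "\<not> consistent M (length zs) (range (\<lambda>i. (\<phi>, s i)))"
    using assms(1) by (auto simp: divides_def)
  have len: "length (s i) = length b" for i using s(2) tuple_equiv_length by metis
  have "\<not> consistent M (length ws) (range (\<lambda>i. (\<phi>', s i)))"
  proof
    assume con: "consistent M (length ws) (range (\<lambda>i. (\<phi>', s i)))"
    have "\<exists>a. length a = length zs \<and> (\<forall>\<sigma>\<in>F. psat M a \<sigma>)"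
      if F: "finite F" "F \<subseteq> range (\<lambda>i. (\<phi>, s i))" for F
    proof -
      obtain J where J: "finite J" "F = (\<lambda>i. (\<phi>, s i)) ` J"
        using finite_subset_image[OF F] by blast
      have "finite ((\<lambda>i. (\<phi>', s i)) ` J)" "(\<lambda>i. (\<phi>', s i)) ` J \<subseteq> range (\<lambda>i. (\<phi>', s i))"
        using J(1) by auto
      then obtain a where a: "length a = length ws" "\<forall>\<sigma> \<in> (\<lambda>i. (\<phi>', s i)) ` J. psat M a \<sigma>"
        using con unfolding consistent_def by blast
      obtain v where v: "map v ws = a" using ex_map_distinct[OF assms(2) a(1)] ..
      have "psat M (map v zs) (\<phi>, s i)" if "i \<in> J" for i
        using a(2) that v eq[OF len[of i], of v] by auto
      then show ?thesis using J(2) by (intro exI[of _ "map v zs"]) auto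
    qed
    then show False using s(3) unfolding consistent_def by blast
  qed
  then show ?thesis using s(1,2) by (auto simp: divides_def)
qed

text \<open>Forking formulas about different subtuples of \<open>A\<close> are brought into common
  variables \<open>ws\<close>, so that their covers by dividing formulas can be united.\<close>

lemma forks_change_variables:
  assumes "forks M (length zs) C \<sigma>" "distinct ws" "set zs \<subseteq> set ws"
  shows "\<exists>\<Psi>. finite \<Psi> \<and> \<Psi> \<subseteq> pformulas M (length ws) UNIV \<and> (\<forall>\<psi> \<in> \<Psi>. divides M (length ws) C \<psi>) \<and>
    (\<forall>v. psat M (map v zs) \<sigma> \<longrightarrow> (\<exists>\<psi> \<in> \<Psi>. psat M (map v ws) \<psi>))"
proof -
  obtain \<Psi> where \<Psi>: "finite \<Psi>" "\<Psi> \<subseteq> pformulas M (length zs) UNIV"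
    "\<forall>\<psi> \<in> \<Psi>. divides M (length zs) C \<psi>"
    "\<forall>a. length a = length zs \<and> psat M a \<sigma> \<longrightarrow> (\<exists>\<psi> \<in> \<Psi>. psat M a \<psi>)"
    using assms(1) unfolding forks_def by blast
  have "\<exists>\<psi>' \<in> pformulas M (length ws) UNIV. divides M (length ws) C \<psi>' \<and>
      (\<forall>v. psat M (map v ws) \<psi>' \<longleftrightarrow> psat M (map v zs) \<psi>)" if "\<psi> \<in> \<Psi>" for \<psi>
  proof -
    obtain \<phi> b where \<psi>: "\<psi> = (\<phi>, b)" by fastforce
    have \<phi>: "\<phi> \<in> formulas M (length zs + length b)" "divides M (length zs) C (\<phi>, b)"
      using \<Psi>(2,3) that by (auto simp: pformulas_def \<psi>)
    from psat_change_variables[OF \<phi>(1) assms(3)] obtain \<phi>' where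
      \<phi>': "\<phi>' \<in> formulas M (length ws + length b)"
      "\<forall>v b'. length b' = length b \<longrightarrow> (psat M (map v ws) (\<phi>', b') \<longleftrightarrow> psat M (map v zs) (\<phi>, b'))"
      by blast
    have "divides M (length ws) C (\<phi>', b)"
      using \<phi>'(2) by (intro divides_change_variables[OF \<phi>(2) assms(2)]) blast
    moreover have "(\<phi>', b) \<in> pformulas M (length ws) UNIV" using \<phi>'(1) by (simp add: pformulas_def)
    ultimately show ?thesis using \<phi>'(2) unfolding \<psi> by blast
  qed
  then obtain f where f: "\<And>\<psi>. \<psi> \<in> \<Psi> \<Longrightarrow> f \<psi> \<in> pformulas M (length ws) UNIV"
    "\<And>\<psi>. \<psi> \<in> \<Psi> \<Longrightarrow> divides M (length ws) C (f \<psi>)"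
    "\<And>\<psi> v. \<psi> \<in> \<Psi> \<Longrightarrow> psat M (map v ws) (f \<psi>) \<longleftrightarrow> psat M (map v zs) \<psi>"
    by metis
  have "\<exists>\<psi> \<in> f ` \<Psi>. psat M (map v ws) \<psi>" if "psat M (map v zs) \<sigma>" for v
    using \<Psi>(4) that f(3) by (metis imageI length_map)
  then show ?thesis
    using \<Psi>(1) f(1,2) by (intro exI[of _ "f ` \<Psi>"]) auto
qed

text \<open>Compactness, with the elements of \<open>A\<close> as variables: \<open>P\<close> is the
  type of \<open>A\<close> over \<open>BC\<close>, and \<open>N\<close> denies every formula over
  \<open>DC\<close> that forks over \<open>C\<close>. If a finite part were unsatisfiable, its
  formulas from \<open>P\<close> would imply a disjunction of forking formulas, hence of dividing
  ones, and would fork themselves.\<close>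

lemma indep_f_extension:
  fixes M :: "('f, 'r, 'a) model"
  assumes M: "monster_model \<kappa> M T" and small: "small \<kappa> A" "small \<kappa> C" "small \<kappa> D"
    and "B \<subseteq> D" and indep: "indep_f M A C B"
  shows "\<exists>A'. set_equiv M (B \<union> C) A A' \<and> indep_f M A' C D"
proof -
  define P where "P = {(xs, \<sigma>). set xs \<subseteq> A \<and> \<sigma> \<in> tp M xs (B \<union> C)}"
  define N where "N = {(xs, (Neg \<phi>, b)) | xs \<phi> b. set xs \<subseteq> A \<and>
    (\<phi>, b) \<in> pformulas M (length xs) (D \<union> C) \<and> forks M (length xs) C (\<phi>, b)}"
  have "\<exists>v. realizes M v (P \<union> N)"
  proof (rule saturated_realizes[of \<kappa> _ A "D \<union> C"])
    show "saturated \<kappa> M" using M by (simp add: monster_model_def)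
    show "Card_order \<kappa>" "infinite (Field \<kappa>)" using monster_infinite[OF M] by blast+
    show "small \<kappa> A" "small \<kappa> (D \<union> C)" using small monster_small_Un[OF M] by blast+
    show "set xs \<subseteq> A \<and> \<sigma> \<in> pformulas M (length xs) (D \<union> C)" if "(xs, \<sigma>) \<in> P \<union> N" for xs \<sigma>
      using that \<open>B \<subseteq> D\<close> by (auto simp: P_def N_def tp_def pformulas_def formulas_def)
    fix \<Sigma> assume \<Sigma>: "finite \<Sigma>" "\<Sigma> \<subseteq> P \<union> N"
    have fin: "finite (\<Union>p\<in>\<Sigma>. set (fst p))" using \<Sigma>(1) by simp
    obtain ws where ws: "set ws = (\<Union>p\<in>\<Sigma>. set (fst p))" "distinct ws"
      using finite_distinct_list[OF fin] by (elim exE conjE)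
    have "definable M (B \<union> C) (set ws) (\<lambda>v. realizes M v (\<Sigma> \<inter> P))"
    proof (rule definable_realizes)
      show "finite (\<Sigma> \<inter> P)" using \<Sigma>(1) by simp
      fix xs \<sigma> assume xs: "(xs, \<sigma>) \<in> \<Sigma> \<inter> P"
      then have "set (fst (xs, \<sigma>)) \<subseteq> set ws" unfolding ws(1) by blast
      then show "set xs \<subseteq> set ws \<and> \<sigma> \<in> pformulas M (length xs) (B \<union> C)"
        using xs by (simp add: P_def tp_def)
    qed
    from definable_imp_pformula[OF this] obtain \<sigma> where
      \<sigma>: "\<sigma> \<in> pformulas M (length ws) (B \<union> C)"
      "\<forall>v. psat M (map v ws) \<sigma> \<longleftrightarrow> realizes M v (\<Sigma> \<inter> P)" by blast
    \<comment> \<open>Every element of \<open>A\<close> is its own variable, so the identity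
      realizes the type of \<open>A\<close>.\<close>
    have "realizes M id (\<Sigma> \<inter> P)" by (auto simp: realizes_def P_def tp_def)
    then have "\<sigma> \<in> tp M ws (B \<union> C)" using \<sigma> by (simp add: tp_def flip: \<sigma>(2)[rule_format])
    moreover have "set ws \<subseteq> A"
    proof -
      have "set (fst p) \<subseteq> A" if "p \<in> P \<union> N" for p
        using that by (auto simp: P_def N_def)
      then show ?thesis using \<Sigma>(2) unfolding ws(1) by blast
    qed
    ultimately have nforks: "\<not> forks M (length ws) C \<sigma>" using indep unfolding indep_f_def by blast
    define covers where "covers p \<Psi> \<longleftrightarrow> finite \<Psi> \<and> \<Psi> \<subseteq> pformulas M (length ws) UNIV \<and>
        (\<forall>\<psi> \<in> \<Psi>. divides M (length ws) C \<psi>) \<and>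
        (\<forall>v. \<not> psat M (map v (fst p)) (snd p) \<longrightarrow> (\<exists>\<psi> \<in> \<Psi>. psat M (map v ws) \<psi>))" for p \<Psi>
    have "\<exists>\<Psi>. covers p \<Psi>" if "p \<in> \<Sigma> - P" for p
    proof -
      have "p \<in> N" using that \<Sigma>(2) by blast
      then obtain xs \<phi> b where p: "p = (xs, (Neg \<phi>, b))" "forks M (length xs) C (\<phi>, b)"
        by (auto simp: N_def)
      have "set (fst p) \<subseteq> set ws" using that unfolding ws(1) by blast
      then have "set xs \<subseteq> set ws" by (simp add: p(1))
      then show ?thesis
        using forks_change_variables[OF p(2) ws(2)] unfolding p(1) covers_def
        by (simp add: psat_Neg)
    qed
    then obtain \<Psi> where \<Psi>: "\<And>p. p \<in> \<Sigma> - P \<Longrightarrow> covers p (\<Psi> p)"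
      by metis
    show "\<exists>v. realizes M v \<Sigma>"
    proof (rule ccontr)
      assume no: "\<nexists>v. realizes M v \<Sigma>"
      have "\<exists>\<psi> \<in> (\<Union>p \<in> \<Sigma> - P. \<Psi> p). psat M a \<psi>" if a: "length a = length ws" "psat M a \<sigma>" for a
      proof -
        obtain v where v: "map v ws = a" using ex_map_distinct[OF ws(2) a(1)] ..
        then have "realizes M v (\<Sigma> \<inter> P)" using a(2) \<sigma>(2) by blast
        moreover have "\<not> realizes M v \<Sigma>" using no by blast
        ultimately obtain p where p: "p \<in> \<Sigma> - P" "\<not> psat M (map v (fst p)) (snd p)"
          unfolding realizes_def case_prod_beta by blast
        then have "\<exists>\<psi> \<in> \<Psi> p. psat M (map v ws) \<psi>"
          using \<Psi>[OF p(1)] by (simp add: covers_def)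
        then show ?thesis using p(1) v by blast
      qed
      moreover have "finite (\<Union>p \<in> \<Sigma> - P. \<Psi> p)"
        using \<Psi> \<Sigma>(1) by (intro finite_UN_I) (simp_all add: covers_def)
      moreover have "(\<Union>p \<in> \<Sigma> - P. \<Psi> p) \<subseteq> pformulas M (length ws) UNIV"
        "\<forall>\<psi> \<in> (\<Union>p \<in> \<Sigma> - P. \<Psi> p). divides M (length ws) C \<psi>"
        using \<Psi> unfolding covers_def by blast+
      ultimately have "forks M (length ws) C \<sigma>"
        unfolding forks_def by (intro exI[of _ "\<Union>p \<in> \<Sigma> - P. \<Psi> p"]) simp
      then show False using nforks by blast
    qed
  qed
  then obtain v where v: "realizes M v (P \<union> N)" by blast
  have "elementary_on M (B \<union> C) A v"
    unfolding elementary_on_def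
  proof (intro allI impI tuple_equivI)
    fix a \<phi> b
    assume "set a \<subseteq> A" "\<phi> \<in> formulas M (length a + length b)" "set b \<subseteq> B \<union> C" "psat M a (\<phi>, b)"
    then have "(a, (\<phi>, b)) \<in> P" by (simp add: P_def tp_def pformulas_def)
    then show "psat M (map v a) (\<phi>, b)" using v by (auto simp: realizes_def)
  qed simp
  then have "set_equiv M (B \<union> C) A (v ` A)" unfolding set_equiv_def by blast
  moreover have "indep_f M (v ` A) C D"
    unfolding indep_f_def
  proof safe
    fix a' \<phi> b assume a': "set a' \<subseteq> v ` A" and \<phi>: "(\<phi>, b) \<in> tp M a' (D \<union> C)"
      and forks: "forks M (length a') C (\<phi>, b)"
    have "a' \<in> lists (v ` A)" using a' by auto
    then obtain a where a: "a' = map v a" "set a \<subseteq> A" by (auto simp: lists_image)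
    then have "(a, (Neg \<phi>, b)) \<in> N" using \<phi> forks by (auto simp: N_def tp_def)
    then have "psat M a' (Neg \<phi>, b)" using v a(1) by (auto simp: realizes_def)
    then show False using \<phi> by (simp add: tp_def psat_Neg)
  qed
  ultimately show ?thesis by blast
qed


section \<open>Dividing and Kim-dividing\<close>

lemma tuple_equiv_psat_params:
  assumes "tuple_equiv M C b b'" "set a \<subseteq> C" "\<phi> \<in> formulas M (length a + length b)"
  shows "psat M a (\<phi>, b) \<longleftrightarrow> psat M a (\<phi>, b')"
proof -
  have "sat M ((!) (a @ b)) \<phi> \<longleftrightarrow> sat M ((!) (a @ b')) \<phi>"
  proof (rule tuple_equiv_sat[OF assms(1)])
    fix i assume "i \<in> fv \<phi>"
    then have i: "i < length a + length b" using assms(3) by (auto simp: formulas_def)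
    show "(a @ b) ! i \<in> C \<and> (a @ b') ! i = (a @ b) ! i \<or>
        (\<exists>j<length b. (a @ b) ! i = b ! j \<and> (a @ b') ! i = b' ! j)"
    proof (cases "i < length a")
      case True
      then show ?thesis using assms(2) by (auto simp: nth_append)
    next
      case False
      then show ?thesis
        using i by (intro disjI2 exI[of _ "i - length a"]) (simp add: nth_append)
    qed
  qed (use assms(3) in \<open>simp add: formulas_def\<close>)
  then show ?thesis
    using assms(3) tuple_equiv_length[OF assms(1)] by (simp add: psat_nth)
qed

text \<open>A tuple \<open>a'\<close> from \<open>C\<close> cannot distinguish parameters of the
  same type over \<open>C\<close>. If it satisfies \<open>\<phi>(x, b)\<close>, it satisfies all
  instances along an indiscernible sequence witnessing dividing over \<open>C\<close>, which is
  absurd; so \<open>a'\<close> satisfies no dividing formula.\<close>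

lemma indep_f_finitely_satisfiable:
  assumes "\<And>a \<sigma>. set a \<subseteq> A \<Longrightarrow> \<sigma> \<in> tp M a (B \<union> C) \<Longrightarrow>
    \<exists>a'. set a' \<subseteq> C \<and> length a' = length a \<and> psat M a' \<sigma>"
  shows "indep_f M A C B"
  unfolding indep_f_def
proof (intro allI impI ballI notI)
  fix a \<sigma> assume "set a \<subseteq> A" "\<sigma> \<in> tp M a (B \<union> C)" and forks: "forks M (length a) C \<sigma>"
  then obtain a' where a': "set a' \<subseteq> C" "length a' = length a" "psat M a' \<sigma>"
    using assms by blast
  obtain \<Psi> where \<Psi>: "\<Psi> \<subseteq> pformulas M (length a) UNIV" "\<forall>\<psi> \<in> \<Psi>. divides M (length a) C \<psi>"
    "\<forall>a'. length a' = length a \<and> psat M a' \<sigma> \<longrightarrow> (\<exists>\<psi> \<in> \<Psi>. psat M a' \<psi>)"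
    using forks unfolding forks_def by blast
  then obtain \<psi> where \<psi>: "\<psi> \<in> \<Psi>" "psat M a' \<psi>" using a'(2,3) by blast
  obtain \<phi> b where \<phi>: "\<psi> = (\<phi>, b)" by fastforce
  have "\<phi> \<in> formulas M (length a' + length b)"
    using \<Psi>(1) \<psi>(1) a'(2) by (auto simp: pformulas_def \<phi>)
  moreover have "divides M (length a) C (\<phi>, b)" using \<Psi>(2) \<psi>(1) \<phi> by blast
  then obtain s where s: "indiscernible M C s" "\<forall>i. tuple_equiv M C (s i) b"
    "\<not> consistent M (length a) (range (\<lambda>i. (\<phi>, s i)))"
    by (rule dividesE)
  ultimately have "psat M a' (\<phi>, s i)" for i
    using tuple_equiv_psat_params[OF tuple_equiv_sym a'(1)] \<psi>(2) \<phi> by metis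
  then have "consistent M (length a) (range (\<lambda>i. (\<phi>, s i)))"
    unfolding consistent_def using a'(2) by blast
  then show False using s(3) by blast
qed

text \<open>The rationals contain a copy of every countable linear order, while the variables, pairs
  of a rational and a coordinate, still form a countable and hence small set.\<close>

lemma indiscernible_stretch:
  fixes M :: "('f, 'r, 'a) model"
  assumes M: "monster_model \<kappa> M T" and C: "small \<kappa> C"
    and ind: "indiscernible M C s" and len: "\<And>i. length (s i) = m"
  shows "\<exists>t :: rat \<Rightarrow> 'a list. \<forall>qs. sorted_wrt (<) qs \<longrightarrow>
    tuple_equiv M C (concat (map s [0..<length qs])) (concat (map t qs))"
proof -
  define var where "var q = map (Pair q) [0..<m]" for q :: rat
  define base where "base k = concat (map s [0..<k])" for k
  have len_var: "length (concat (map var qs)) = length qs * m" for qs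
    by (induction qs) (simp_all add: var_def)
  have len_base: "length (base k) = k * m" for k
    by (induction k) (simp_all add: base_def len)
  define I where "I = {p :: rat list \<times> ('f, 'r, 'a) pfm. sorted_wrt (<) (fst p) \<and> snd p \<in> tp M (base (length (fst p))) C}"
  define F where "F p = (concat (map var (fst p)), snd p)"
    for p :: "rat list \<times> ('f, 'r, 'a) pfm"
  have "\<exists>v. realizes M v (F ` I)"
  proof (rule saturated_realizes[of \<kappa> _ UNIV C])
    show "saturated \<kappa> M" using M by (simp add: monster_model_def)
    show "Card_order \<kappa>" "infinite (Field \<kappa>)" using monster_infinite[OF M] by blast+
    show "small \<kappa> (UNIV :: (rat \<times> nat) set)" by (rule small_countable[OF M countableI_type])
    show "small \<kappa> C" by (rule C)
    show "set xs \<subseteq> UNIV \<and> \<sigma> \<in> pformulas M (length xs) C" if "(xs, \<sigma>) \<in> F ` I" for xs \<sigma>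
      using that by (auto simp: F_def I_def tp_iff len_base len_var)
    fix \<Sigma> assume \<Sigma>: "finite \<Sigma>" "\<Sigma> \<subseteq> F ` I"
    then obtain J where J: "J \<subseteq> I" "finite J" "\<Sigma> = F ` J" by (metis finite_subset_image)
    define Q where "Q = (\<Union>p\<in>J. set (fst p))"
    have "finite Q" using J(2) by (simp add: Q_def)
    \<comment> \<open>Counting the elements of \<open>Q\<close> below \<open>q\<close> embeds the
      finite order \<open>Q\<close> into the natural numbers, so terms of the given sequence satisfy
      the finitely many demands.\<close>
    define e where "e q = card {p \<in> Q. p < q}" for q
    have e: "e p < e q" if "p \<in> Q" "p < q" for p q
      unfolding e_def by (rule psubset_card_mono) (use \<open>finite Q\<close> that in auto)
    define v where "v p = s (e (fst p)) ! snd p" for p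
    have v_var: "map v (var q) = s (e q)" for q
      using map_nth[of "s (e q)"] by (simp add: var_def v_def comp_def len)
    have "psat M (map v (concat (map var qs))) \<sigma>" if "(qs, \<sigma>) \<in> J" for qs \<sigma>
    proof -
      have qs: "sorted_wrt (<) qs" "\<sigma> \<in> tp M (base (length qs)) C"
        using that J(1) by (auto simp: I_def)
      have "set (fst (qs, \<sigma>)) \<subseteq> Q" unfolding Q_def using that by blast
      then have "sorted_wrt (<) (map e qs)"
        unfolding sorted_wrt_map using e by (intro sorted_wrt_mono_rel[OF _ qs(1)]) auto
      then have "tuple_equiv M C (base (length qs)) (concat (map s (map e qs)))"
        using ind unfolding indiscernible_def base_def
        by (metis length_map length_upt minus_nat.diff_0 sorted_wrt_upt)
      then have "psat M (concat (map s (map e qs))) \<sigma>"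
        using qs(2) tuple_equiv_psat unfolding tp_iff by metis
      moreover have "map v (concat (map var qs)) = concat (map s (map e qs))"
        by (simp add: map_concat comp_def v_var)
      ultimately show ?thesis by simp
    qed
    then have "realizes M v \<Sigma>" by (auto simp: realizes_def J(3) F_def)
    then show "\<exists>v. realizes M v \<Sigma>" by blast
  qed
  then obtain v where v: "realizes M v (F ` I)" by blast
  have "tuple_equiv M C (base (length qs)) (concat (map (\<lambda>q. map v (var q)) qs))"
    if "sorted_wrt (<) qs" for qs
  proof -
    have eq: "concat (map (\<lambda>q. map v (var q)) qs) = map v (concat (map var qs))"
      by (simp add: map_concat comp_def)
    show ?thesis
      unfolding eq
    proof (rule tuple_equivI)
      show "length (map v (concat (map var qs))) = length (base (length qs))"
        by (simp only: length_map len_var len_base)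
      fix \<phi> b assume "\<phi> \<in> formulas M (length (base (length qs)) + length b)" "set b \<subseteq> C"
        "psat M (base (length qs)) (\<phi>, b)"
      then have "(qs, (\<phi>, b)) \<in> I" using that by (simp add: I_def tp_def pformulas_def)
      then have "F (qs, (\<phi>, b)) \<in> F ` I" by (rule imageI)
      then show "psat M (map v (concat (map var qs))) (\<phi>, b)"
        using v by (force simp: realizes_def F_def)
    qed
  qed
  then show ?thesis unfolding base_def by blast
qed

text \<open>
  Stretch the sequence witnessing that \<open>\<phi>(x, b)\<close> divides over \<open>C\<close> to the order type \<open>\<omega> + \<omega>\<^sup>*\<close>,
  moved so that it starts with \<open>b\<close>. Over \<open>C\<close> together with the upper half \<open>I\<close>, the type of each
  term of the lower half over its predecessors is finitely satisfiable in \<open>I\<close>, so the lower half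
  is a Morley sequence.
\<close>

lemma divides_imp_kim_divides:
  fixes M :: "('f, 'r, 'a) model"
  assumes M: "monster_model \<kappa> M T" and C: "small \<kappa> C"
    and div: "divides M n C (\<phi>, b)" and \<phi>: "\<phi> \<in> formulas M (n + length b)"
  shows "\<exists>I. countable I \<and> kim_divides M n (C \<union> I) (\<phi>, b)"
proof -
  have hom: "strongly_homogeneous \<kappa> M" using M by (simp add: monster_model_def)
  have smallC: "small \<kappa> (C \<union> set l)" for l
    by (intro monster_small_Un[OF M C] small_countable[OF M] countable_finite finite_set)
  obtain s where s: "indiscernible M C s" "\<forall>i. tuple_equiv M C (s i) b"
    "\<not> consistent M n (range (\<lambda>i. (\<phi>, s i)))"
    using div by (auto simp: divides_def)
  have len_s: "length (s i) = length b" for i using s(2) tuple_equiv_length by metis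
  obtain t\<^sub>0 :: "rat \<Rightarrow> 'a list" where t\<^sub>0: "\<And>qs. sorted_wrt (<) qs \<Longrightarrow>
      tuple_equiv M C (concat (map s [0..<length qs])) (concat (map t\<^sub>0 qs))"
    using indiscernible_stretch[OF M C s(1) len_s] by blast
  \<comment> \<open>The index -1 will be \<open>lo 0\<close>. The sequence has to start with
    \<open>b\<close> itself because its terms must have the type of \<open>b\<close> over
    \<open>C \<union> I\<close>, not only over \<open>C\<close>.\<close>
  have "tuple_equiv M C (t\<^sub>0 (-1)) b"
    using t\<^sub>0[of "[-1]"] s(2) tuple_equiv_sym tuple_equiv_trans by fastforce
  then obtain h where h: "automorphism M h" "\<forall>c \<in> C. h c = c" "map h (t\<^sub>0 (-1)) = b"
    using strongly_homogeneous_tuple[OF hom smallC] by blast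
  define t where "t = (\<lambda>q. map h (t\<^sub>0 q))"
  have t: "tuple_equiv M C (concat (map s [0..<length qs])) (concat (map t qs))"
    if "sorted_wrt (<) qs" for qs
  proof -
    have "tuple_equiv M C (concat (map t\<^sub>0 qs)) (map h (concat (map t\<^sub>0 qs)))"
      by (rule automorphism_tuple_equiv) (use h in auto)
    moreover have "map h (concat (map t\<^sub>0 qs)) = concat (map t qs)"
      by (simp add: map_concat comp_def t_def)
    ultimately show ?thesis using tuple_equiv_trans[OF t\<^sub>0[OF that]] by simp
  qed
  have len_t: "length (t q) = length b" for q
    using tuple_equiv_length[OF t[of "[q]"]] by (simp add: len_s)
  \<comment> \<open>A block of terms may be exchanged for another block of the same length in the
    same cut, over all the terms on either side.\<close>
  have move: "tuple_equiv M (C \<union> (\<Union>q \<in> set qs\<^sub>1. set (t q)) \<union> (\<Union>q \<in> set qs\<^sub>3. set (t q)))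
      (concat (map t qs\<^sub>2)) (concat (map t qs\<^sub>2'))"
    if "sorted_wrt (<) (qs\<^sub>1 @ qs\<^sub>2 @ qs\<^sub>3)" "sorted_wrt (<) (qs\<^sub>1 @ qs\<^sub>2' @ qs\<^sub>3)"
      "length qs\<^sub>2' = length qs\<^sub>2" for qs\<^sub>1 qs\<^sub>2 qs\<^sub>2' qs\<^sub>3
  proof -
    have "tuple_equiv M C (concat (map t (qs\<^sub>1 @ qs\<^sub>2 @ qs\<^sub>3))) (concat (map t (qs\<^sub>1 @ qs\<^sub>2' @ qs\<^sub>3)))"
      using tuple_equiv_trans[OF tuple_equiv_sym[OF t[OF that(1)]]] t[OF that(2)] that(3) by simp
    moreover have "length (concat (map t qs)) = length qs * length b" for qs
      by (induction qs) (simp_all add: len_t)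
    ultimately show ?thesis
      using tuple_equiv_add_params[of M C "concat (map t qs\<^sub>1)" "concat (map t qs\<^sub>2)"
          "concat (map t qs\<^sub>3)" "concat (map t qs\<^sub>2')"] that(3) by simp
  qed
  \<comment> \<open>\<open>lo\<close> increases from -1 and \<open>hi\<close> decreases from 1, both
    towards 0 and without reaching it: together a copy of \<open>\<omega>\<close> followed by a
    reversed \<open>\<omega>\<close>.\<close>
  define lo hi :: "nat \<Rightarrow> rat" where "lo k = - 1 / (of_nat k + 1)" and "hi k = 1 / (of_nat k + 1)" for k
  have lo_less: "lo i < lo j" if "i < j" for i j
    using that by (simp add: lo_def field_simps)
  have hi_less: "hi j < hi i" if "i < j" for i j
    using that by (simp add: hi_def field_simps)
  have lo_hi: "lo i < hi j" for i j
    by (rule less_trans[of _ 0]) (simp_all add: lo_def hi_def)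
  have sorted_lo: "sorted_wrt (<) (map lo is)" if "sorted_wrt (<) is" for "is"
    unfolding sorted_wrt_map by (rule sorted_wrt_mono_rel[OF _ that]) (rule lo_less)
  \<comment> \<open>Reversed, since \<open>hi\<close> is decreasing and the blocks are listed in
    increasing order.\<close>
  define his where "his N = map hi (rev [0..<N])" for N
  have sorted_his: "sorted_wrt (<) (his N)" for N
    unfolding his_def sorted_wrt_map sorted_wrt_rev
    by (rule sorted_wrt_mono_rel[OF _ sorted_wrt_upt]) (rule hi_less)
  have set_his: "set (his N) = hi ` {..<N}" for N by (auto simp: his_def)
  define u where "u k = t (lo k)" for k
  define I where "I = (\<Union>k. set (t (hi k)))"
  have u0: "u 0 = b" using h(3) by (simp add: u_def lo_def t_def)
  have map_u: "map u is = map t (map lo is)" for "is" by (simp add: u_def)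
  have finite_I: "\<exists>N. F \<inter> I \<subseteq> (\<Union>q \<in> set (his N). set (t q))" if "finite F" for F
  proof -
    have "finite (F \<inter> I)" using that by simp
    moreover have "\<forall>x \<in> F \<inter> I. \<exists>k. x \<in> set (t (hi k))" by (auto simp: I_def)
    then obtain k where k: "\<And>x. x \<in> F \<inter> I \<Longrightarrow> x \<in> set (t (hi (k x)))" by metis
    ultimately obtain N where "\<forall>x \<in> F \<inter> I. k x < N"
      using finite_nat_set_iff_bounded[of "k ` (F \<inter> I)"] by auto
    then have "F \<inter> I \<subseteq> (\<Union>q \<in> set (his N). set (t q))" using k unfolding set_his by blast
    then show ?thesis ..
  qed
  have ind: "indiscernible M (C \<union> I) u"
    unfolding indiscernible_def
  proof (intro allI impI, rule tuple_equiv_finite_params)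
    fix "is" js :: "nat list" and F
    assume *: "sorted_wrt (<) is \<and> sorted_wrt (<) js \<and> length is = length js"
      and F: "finite F" "F \<subseteq> C \<union> I"
    obtain N where N: "F \<inter> I \<subseteq> (\<Union>q \<in> set (his N). set (t q))" using finite_I[OF F(1)] by (rule exE)
    have "tuple_equiv M (C \<union> (\<Union>q \<in> set []. set (t q)) \<union> (\<Union>q \<in> set (his N). set (t q)))
        (concat (map t (map lo is))) (concat (map t (map lo js)))"
      by (rule move) (use * sorted_lo sorted_his lo_hi in \<open>auto simp: sorted_wrt_append set_his\<close>)
    then show "tuple_equiv M F (concat (map u is)) (concat (map u js))"
      unfolding map_u by (rule tuple_equiv_mono) (use F(2) N in auto)
  qed
  have "tuple_equiv M (C \<union> I) (u i) b" for i
    using ind[unfolded indiscernible_def, rule_format, of "[i]" "[0]"] by (simp add: u0)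
  moreover have "indep_f M (set (u i)) (C \<union> I) (\<Union>j<i. set (u j))" for i
  proof (rule indep_f_finitely_satisfiable)
    fix a \<sigma> assume a: "set a \<subseteq> set (u i)" and \<sigma>: "\<sigma> \<in> tp M a ((\<Union>j<i. set (u j)) \<union> (C \<union> I))"
    have p: "set (snd \<sigma>) \<subseteq> (\<Union>j<i. set (u j)) \<union> (C \<union> I)"
      using \<sigma> by (auto simp: tp_def pformulas_def)
    obtain N where N: "set (snd \<sigma>) \<inter> I \<subseteq> (\<Union>q \<in> set (his N). set (t q))"
      using finite_I[of "set (snd \<sigma>)"] by auto
    \<comment> \<open>No parameter of \<open>\<sigma>\<close> separates \<open>lo i\<close> from
      \<open>hi N\<close>: those from \<open>I\<close> belong to the first \<open>N\<close> terms of
      \<open>hi\<close>, which lie above both, and the predecessors of \<open>u i\<close> lie below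
      both. So \<open>u i\<close> can be replaced by a tuple inside \<open>I\<close>.\<close>
    have "tuple_equiv M (C \<union> (\<Union>q \<in> set (map lo [0..<i]). set (t q)) \<union>
        (\<Union>q \<in> set (his N). set (t q))) (concat (map t [lo i])) (concat (map t [hi N]))"
      by (rule move)
        (use sorted_lo[OF sorted_wrt_upt] sorted_his lo_hi lo_less hi_less in
          \<open>auto simp: sorted_wrt_append set_his\<close>)
    then have "tuple_equiv M (set (snd \<sigma>)) (u i) (t (hi N))"
      unfolding u_def[of i] concat.simps list.map append_Nil2
      by (rule tuple_equiv_mono) (use p N in \<open>auto simp: u_def\<close>)
    then obtain a' where a': "set a' \<subseteq> set (t (hi N))" "tuple_equiv M (set (snd \<sigma>)) a a'"
      using tuple_equiv_subtuple a by blast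
    have "psat M a' \<sigma>"
      using \<sigma> tuple_equiv_psat[OF a'(2), of \<sigma>] by (auto simp: tp_def pformulas_def)
    moreover have "set a' \<subseteq> C \<union> I" using a'(1) by (auto simp: I_def)
    ultimately show "\<exists>a'. set a' \<subseteq> C \<union> I \<and> length a' = length a \<and> psat M a' \<sigma>"
      using tuple_equiv_length[OF a'(2)] by blast
  qed
  moreover have "\<not> consistent M n (range (\<lambda>i. (\<phi>, u i)))"
  proof
    assume con: "consistent M n (range (\<lambda>i. (\<phi>, u i)))"
    have "\<exists>a. length a = n \<and> (\<forall>\<sigma>\<in>F. psat M a \<sigma>)"
      if F: "finite F" "F \<subseteq> range (\<lambda>i. (\<phi>, s i))" for F
    proof -
      obtain J where J: "finite J" "F = (\<lambda>i. (\<phi>, s i)) ` J"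
        using finite_subset_image[OF F] by blast
      obtain N where N: "\<forall>j \<in> J. j < N" using J(1) finite_nat_set_iff_bounded by blast
      have "finite ((\<lambda>i. (\<phi>, u i)) ` {..<N})" "(\<lambda>i. (\<phi>, u i)) ` {..<N} \<subseteq> range (\<lambda>i. (\<phi>, u i))"
        by auto
      then obtain a where a: "length a = n" "\<forall>\<sigma> \<in> (\<lambda>i. (\<phi>, u i)) ` {..<N}. psat M a \<sigma>"
        using con unfolding consistent_def by blast
      \<comment> \<open>Initial segments of \<open>u\<close> and of the original sequence have the
        same type over \<open>C\<close>, so an automorphism carries a common solution along
        \<open>u\<close> to one along \<open>s\<close>.\<close>
      have "tuple_equiv M C (concat (map u [0..<N])) (concat (map s [0..<N]))"
        using tuple_equiv_sym[OF t[OF sorted_lo[OF sorted_wrt_upt[of 0 N]]]] by (simp add: map_u)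
      then obtain g where g: "automorphism M g"
        "map g (concat (map u [0..<N])) = concat (map s [0..<N])"
        using strongly_homogeneous_tuple[OF hom smallC] by blast
      have "concat (map (\<lambda>i. map g (u i)) [0..<N]) = concat (map s [0..<N])"
        using g(2) by (simp add: map_concat comp_def)
      then have "map (\<lambda>i. map g (u i)) [0..<N] = map s [0..<N]"
        by (subst (asm) concat_eq_concat_iff) (auto simp: zip_map_map zip_same_conv_map u_def len_t len_s)
      then have gu: "map g (u i) = s i" if "i < N" for i using that by simp
      have "psat M (map g a) (\<phi>, s i)" if "i \<in> J" for i
      proof -
        have "i < N" using N that by blast
        then have "psat M a (\<phi>, u i)" using a(2) by blast
        then have "psat M (map g a) (\<phi>, map g (u i))"
          using automorphism_psat[OF g(1), of \<phi> a "u i"] \<phi> a(1) by (simp add: u_def len_t)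
        then show ?thesis using gu \<open>i < N\<close> by simp
      qed
      then show ?thesis using J(2) a(1) by (intro exI[of _ "map g a"]) auto
    qed
    then show False using s(3) unfolding consistent_def by blast
  qed
  ultimately have "kim_divides M n (C \<union> I) (\<phi>, b)"
    using ind by (auto simp: kim_divides_def morley_sequence_def)
  moreover have "countable I" by (auto simp: I_def intro: countable_finite)
  ultimately show ?thesis by blast
qed

section \<open>Forking independence and Kim-independence\<close>

lemma indep_f_imp_star_upM:
  assumes M: "monster_model \<kappa> M T" and small: "small \<kappa> A" "small \<kappa> C"
    and indep: "indep_f M A C B"
  shows "star \<kappa> M (upM M (indep_K M)) A C B"
  unfolding star_def
proof (intro allI impI)
  fix D assume D: "small \<kappa> D \<and> B \<subseteq> D"
  \<comment> \<open>The bases \<open>E\<close> lie within \<open>acl M (D \<union> C)\<close>, so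
    formulas over \<open>D \<union> E\<close> have their parameters in \<open>D'\<close>, and
    non-forking over \<open>C\<close> must be arranged for all of them at once.\<close>
  define D' where "D' = D \<union> acl M (D \<union> C)"
  have "small \<kappa> D'"
    unfolding D'_def using M D small(2) by (intro monster_small_Un small_acl) auto
  then obtain A' where A': "set_equiv M (B \<union> C) A A'" "indep_f M A' C D'"
    using indep_f_extension[OF M small _ _ indep, of D'] D by (auto simp: D'_def)
  have "indep_K M A' E D" if E: "C \<subseteq> E" "E \<subseteq> acl M (D \<union> C)" for E
    unfolding indep_K_def
  proof (intro allI impI ballI notI)
    fix a \<sigma> assume a: "set a \<subseteq> A'" and \<sigma>: "\<sigma> \<in> tp M a (D \<union> E)"
      and "kim_divides M (length a) E \<sigma>"
    then have "divides M (length a) C \<sigma>"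
      using E(1) by (blast intro: divides_mono kim_divides_imp_divides)
    moreover have "\<sigma> \<in> pformulas M (length a) UNIV" "\<sigma> \<in> tp M a (D' \<union> C)"
      using \<sigma> E(2) by (auto simp: tp_def pformulas_def D'_def)
    ultimately show False
      using A'(2) a divides_imp_forks unfolding indep_f_def by blast
  qed
  then show "\<exists>A'. set_equiv M (B \<union> C) A A' \<and> upM M (indep_K M) A' C D"
    using A'(1) unfolding upM_def by blast
qed

lemma upM_imp_upm: "upM M R A C B \<Longrightarrow> upm R A C B"
  using subset_acl[of "B \<union> C" M] unfolding upM_def upm_def by blast

lemma star_mono:
  "star \<kappa> M R A C B \<Longrightarrow> (\<And>A B. R A C B \<Longrightarrow> S A C B) \<Longrightarrow> star \<kappa> M S A C B"
  unfolding star_def by blast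

lemma star_upm_imp_indep_f:
  fixes M :: "('f, 'r, 'a) model"
  assumes M: "monster_model \<kappa> M T" and small: "small \<kappa> B" "small \<kappa> C"
    and star: "star \<kappa> M (upm (indep_K M)) A C B"
  shows "indep_f M A C B"
  unfolding indep_f_def
proof (intro allI impI ballI notI)
  fix a \<sigma> assume a: "set a \<subseteq> A" and \<sigma>: "\<sigma> \<in> tp M a (B \<union> C)"
    and forks: "forks M (length a) C \<sigma>"
  obtain \<Psi> where \<Psi>: "finite \<Psi>" "\<Psi> \<subseteq> pformulas M (length a) UNIV"
    "\<forall>\<psi> \<in> \<Psi>. divides M (length a) C \<psi>"
    "\<forall>a'. length a' = length a \<and> psat M a' \<sigma> \<longrightarrow> (\<exists>\<psi> \<in> \<Psi>. psat M a' \<psi>)"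
    using forks unfolding forks_def by blast
  have "\<exists>I. countable I \<and> kim_divides M (length a) (C \<union> I) \<psi>" if "\<psi> \<in> \<Psi>" for \<psi>
    using divides_imp_kim_divides[OF M small(2), of "length a" "fst \<psi>" "snd \<psi>"] \<Psi>(2,3) that
    by (auto simp: pformulas_def)
  then obtain I where I: "\<And>\<psi>. \<psi> \<in> \<Psi> \<Longrightarrow> countable (I \<psi>)"
    "\<And>\<psi>. \<psi> \<in> \<Psi> \<Longrightarrow> kim_divides M (length a) (C \<union> I \<psi>) \<psi>"
    by metis
  \<comment> \<open>Which \<open>\<psi>\<close> the conjugate of \<open>a\<close> will satisfy is
    not known in advance, and each has its own base \<open>C \<union> I \<psi>\<close>. All
    parameters and all bases are therefore put into \<open>D\<close> before the conjugate is
    taken.\<close>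
  define D where "D = B \<union> (\<Union>\<psi> \<in> \<Psi>. set (snd \<psi>) \<union> I \<psi>)"
  have "countable (\<Union>\<psi> \<in> \<Psi>. set (snd \<psi>) \<union> I \<psi>)"
    using \<Psi>(1) I(1) by (intro countable_UN countable_Un) (auto intro: countable_finite)
  then have "small \<kappa> D"
    unfolding D_def using small_countable[OF M] by (intro monster_small_Un[OF M small(1)])
  then obtain A' where A': "set_equiv M (B \<union> C) A A'" "upm (indep_K M) A' C D"
    using star unfolding star_def D_def by blast
  obtain g where g: "g ` A = A'" "elementary_on M (B \<union> C) A g"
    using A'(1) unfolding set_equiv_def by blast
  \<comment> \<open>The conjugate still satisfies \<open>\<sigma>\<close>, a formula over
    \<open>BC\<close>, and so falls under one of the \<open>\<psi>\<close>; \<open>upm\<close>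
    yields independence precisely over the base where that \<open>\<psi>\<close>
    Kim-divides.\<close>
  have "tuple_equiv M (B \<union> C) a (map g a)" using g(2) a unfolding elementary_on_def by blast
  then have "psat M (map g a) \<sigma>" using \<sigma> tuple_equiv_psat unfolding tp_iff by metis
  then obtain \<psi> where \<psi>: "\<psi> \<in> \<Psi>" "psat M (map g a) \<psi>" using \<Psi>(4)[rule_format, of "map g a"] by auto
  have sub: "set (snd \<psi>) \<subseteq> D" "I \<psi> \<subseteq> D" using \<psi>(1) unfolding D_def by blast+
  have "\<psi> \<in> tp M (map g a) (D \<union> (C \<union> I \<psi>))"
    using \<Psi>(2) \<psi> sub(1) by (auto simp: tp_def pformulas_def)
  moreover have "indep_K M A' (C \<union> I \<psi>) D" using A'(2) sub(2) unfolding upm_def by blast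
  moreover have "set (map g a) \<subseteq> A'" using a g(1) by auto
  ultimately have "\<not> kim_divides M (length (map g a)) (C \<union> I \<psi>) \<psi>" unfolding indep_K_def by blast
  then show False using I(2)[OF \<psi>(1)] by simp
qed

theorem proposition2p13:
  fixes M :: "('f, 'r, 'a) model" and T :: "('f, 'r) fm set" and \<kappa> :: "'k rel"
  assumes "complete_theory M T"
    and "monster_model \<kappa> M T"
    and "NSOP1 M"
  shows "\<forall>A B C. small \<kappa> A \<and> small \<kappa> B \<and> small \<kappa> C \<longrightarrow>
           (indep_f M A C B \<longleftrightarrow> star \<kappa> M (upM M (indep_K M)) A C B) \<and>
           (indep_f M A C B \<longleftrightarrow> star \<kappa> M (upm (indep_K M)) A C B)"
proof (intro allI impI)
  fix A B C :: "'a set"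
  assume small: "small \<kappa> A \<and> small \<kappa> B \<and> small \<kappa> C"
  have "star \<kappa> M (upM M (indep_K M)) A C B" if "indep_f M A C B"
    using indep_f_imp_star_upM[OF assms(2)] small that by blast
  moreover have "star \<kappa> M (upm (indep_K M)) A C B" if "star \<kappa> M (upM M (indep_K M)) A C B"
    using star_mono[OF that upM_imp_upm] .
  moreover have "indep_f M A C B" if "star \<kappa> M (upm (indep_K M)) A C B"
    using star_upm_imp_indep_f[OF assms(2)] small that by blast
  ultimately show "(indep_f M A C B \<longleftrightarrow> star \<kappa> M (upM M (indep_K M)) A C B) \<and>
      (indep_f M A C B \<longleftrightarrow> star \<kappa> M (upm (indep_K M)) A C B)"
    by blast
qed

end
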